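(* Let $d\ge1$. Suppose $f$ and $g$ are measurable real-valued functions on a measurable set $R\subset\mathbb{R}^{d}$ which contains $\mathbf{0}$ as an interior point. Suppose that $f$ attains its unique minimum value of $0$ at $\mathbf{0}\in R$ and is otherwise bounded away from zero (for every $\delta>0$, $\inf\{f(\mathbf{x}):\mathbf{x}\in R,\ |\mathbf{x}|\ge\delta\}>0$), and that there are a positive integer $N$, real numbers $\nu>0$ and $\lambda>0$, continuous functions $f_{0},\dots,f_{N}$ on $S^{d-1}$ with $f_{0}>0$, and functions $g_{0},\dots,g_{N}$ on $S^{d-1}$ such that, as $\rho\to0$, $$f(\rho,\Omega)=\rho^{\nu}\sum_{j=0}^{N}f_{j}(\Omega)\rho^{j}+o(\rho^{N+\nu}),\qquad g(\rho,\Omega)=\rho^{\lambda-d}\sum_{j=0}^{N}g_{j}(\Omega)\rho^{j}+o(\rho^{N+\lambda-d}).$$ Suppose there exists $k_{0}>0$ such that $\int_{R}e^{-k_{0}f}g\,d^{d}\mathbf{x}$ converges. If, in addition, $\rho^{-\nu}f(\rho,\Omega)$ is continuous at $\rho=0$, so that $f_{0}(\Omega)=f_{0}$ is constant, then there exists an asymptotic expansion $$\int_{R}e^{-kf}g\,d^{d}\mathbf{x}=\sum_{j=0}^{N}\zeta_{j}k^{-(j+\lambda)/\nu}+o\left(k^{-(N+\lambda)/\nu}\right),\qquad k\rightarrow\infty,$$ where the coefficients are given by $$\zeta_{j}=\frac{1}{\nu}\Gamma\left(\frac{j+\lambda}{\nu}\right)f_{0}^{-(j+\lambda)/\nu}\sum_{m=0}^{j}\sum_{r=1}^{m}\binom{-\frac{j+\lambda}{\nu}}{r}f_{0}^{-r}\int_{S^{d-1}}g_{j-m}(\Omega)f_{m}^{(r)}(\Omega)\,d\Omega,$$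 in which the (empty) sum over $r$ for $m=0$ is understood as $\int_{S^{d-1}}g_{j}(\Omega)\,d\Omega$.
   Context: Spherical coordinates: $\rho=|\mathbf{x}|$ and $\Omega=\mathbf{x}/\rho\in S^{d-1}=\{|\mathbf{x}|=1\}\subset\mathbb{R}^{d}$; $f(\rho,\Omega)$ means $f(\rho\Omega)$, and similarly for $g$. $d\Omega$ is the standard surface measure on $S^{d-1}$ (counting measure on $S^{0}=\{\pm1\}$ if $d=1$). The expansions of $f$ and $g$ are asymptotic expansions as $|\mathbf{x}|\to0$, i.e. the $o(\cdot)$ error terms are uniform in $\Omega$. "$\rho^{-\nu}f$ is continuous at $\rho=0$" means that $|\mathbf{x}|^{-\nu}f(\mathbf{x})$ has a finite limit as $\mathbf{x}\to\mathbf{0}$. For $1\le r\le m$, $$f_{m}^{(r)}(\Omega)=\sum_{\substack{n_{1}+\cdots+n_{r}=m\\ n_{i}\geq1,\ i=1,\dots,r}}f_{n_{1}}(\Omega)\cdots f_{n_{r}}(\Omega).$$ $\binom{\alpha}{r}=\alpha(\alpha-1)\cdots(\alpha-r+1)/r!$ for real $\alpha$. Integrals are Lebesgue integrals, and "converges" means the integrand is Lebesgue integrable. $h(k)=o(k^{p})$ as $k\to\infty$ means $\lim_{k\to\infty}k^{-p}h(k)=0$. *)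

theory Defs
  imports "HOL-Analysis.Analysis" "HOL-Library.Landau_Symbols"
begin

text \<open>
  Surface measure on the unit sphere: the measure of a Borel set of directions is the dimension
  times the Lebesgue measure of the part of the unit ball lying over it, as in the polar coordinate
  formula for Lebesgue measure. The completion is taken because the coefficient functions \<open>G j\<close> of
  a merely Lebesgue measurable integrand need not be Borel measurable.
\<close>

definition surface_measure :: "'a::euclidean_space measure" where
  "surface_measure =
     completion
       (scale_measure (of_nat DIM('a))
         (distr (restrict_space lborel (cball 0 1 - {0}))
                (restrict_space borel (sphere 0 1))
                (\<lambda>x. x /\<^sub>R norm x)))"

lemma space_surface_measure [simp]: "space surface_measure = sphere 0 1"
  by (simp add: surface_measure_def space_restrict_space space_scale_measure)

lemma emeasure_surface_measure:
  fixes A :: "'a::euclidean_space set"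
  assumes "A \<in> sets borel" "A \<subseteq> sphere 0 1"
  shows "emeasure surface_measure A =
           of_nat DIM('a) * emeasure lborel {x \<in> cball 0 1 - {0}. x /\<^sub>R norm x \<in> A}"
proof -
  let ?B = "restrict_space lborel (cball 0 1 - {0 :: 'a})"
  let ?S = "restrict_space borel (sphere 0 (1::real)) :: 'a measure"
  have A: "A \<in> sets ?S"
    using assms by (auto simp: sets_restrict_space)
  have m: "(\<lambda>x. x /\<^sub>R norm x) \<in> measurable ?B ?S"
    by (rule measurable_restrict_space2)
       (auto simp: space_restrict_space intro!: measurable_restrict_space1)
  have vimage: "(\<lambda>x. x /\<^sub>R norm x) -` A \<inter> space ?B = {x \<in> cball 0 1 - {0}. x /\<^sub>R norm x \<in> A}"
    by (auto simp: space_restrict_space)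
  have "emeasure surface_measure A = of_nat DIM('a) * emeasure (distr ?B ?S (\<lambda>x. x /\<^sub>R norm x)) A"
    unfolding surface_measure_def
    using A by (subst emeasure_completion) (auto simp: sets_scale_measure)
  also have "emeasure (distr ?B ?S (\<lambda>x. x /\<^sub>R norm x)) A
      = emeasure ?B {x \<in> cball 0 1 - {0}. x /\<^sub>R norm x \<in> A}"
    by (simp only: emeasure_distr[OF m A] vimage)
  also have "\<dots> = emeasure lborel {x \<in> cball 0 1 - {0}. x /\<^sub>R norm x \<in> A}"
    by (subst emeasure_restrict_space) auto
  finally show ?thesis .
qed

text \<open>In dimension one this is counting measure on the two-point sphere.\<close>

lemma emeasure_surface_measure_real:
  "emeasure surface_measure {1 :: real} = 1" "emeasure surface_measure {-1 :: real} = 1"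
proof -
  have "{x \<in> cball 0 1 - {0}. x /\<^sub>R norm x \<in> {1 :: real}} = {0<..1}"
    "{x \<in> cball 0 1 - {0}. x /\<^sub>R norm x \<in> {-1 :: real}} = {-1..<0}"
    by (auto simp: field_simps abs_if split: if_splits)
  then show "emeasure surface_measure {1 :: real} = 1" "emeasure surface_measure {-1 :: real} = 1"
    by (auto simp: emeasure_surface_measure)
qed

text \<open>
  The sum \<open>f\<^sub>m\<^sup>(\<^sup>r\<^sup>)(\<Omega>)\<close>, indexed by the lists
  \<open>ns = [n\<^sub>1, \<dots>, n\<^sub>r]\<close> of positive integers with sum \<open>m\<close>.
\<close>

definition comp_sum :: "(nat \<Rightarrow> 'a \<Rightarrow> real) \<Rightarrow> nat \<Rightarrow> nat \<Rightarrow> 'a \<Rightarrow> real" where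
  "comp_sum F m r \<Omega> =
     (\<Sum>ns | length ns = r \<and> (\<forall>n\<in>set ns. 1 \<le> n) \<and> sum_list ns = m. \<Prod>n\<leftarrow>ns. F n \<Omega>)"

lemma finite_comp_sum_index:
  "finite {ns :: nat list. length ns = r \<and> (\<forall>n\<in>set ns. 1 \<le> n) \<and> sum_list ns = m}"
  by (rule finite_subset[OF _ finite_lists_length_eq[of "{..m}" r]])
     (auto dest: member_le_sum_list)

text \<open>
  The coefficient \<open>\<zeta>\<^sub>j\<close>; here \<open>c\<close> is the constant value of \<open>F 0\<close>.
\<close>

definition zeta_coeff ::
  "real \<Rightarrow> real \<Rightarrow> real \<Rightarrow> (nat \<Rightarrow> 'a::euclidean_space \<Rightarrow> real) \<Rightarrow> (nat \<Rightarrow> 'a \<Rightarrow> real) \<Rightarrow> nat \<Rightarrow> real" where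
  "zeta_coeff \<nu> l c F G j =
     1 / \<nu> * Gamma ((real j + l) / \<nu>) * c powr (- (real j + l) / \<nu>) *
     (\<Sum>m\<le>j.
        if m = 0 then integral\<^sup>L surface_measure (G j)
        else (\<Sum>r=1..m. ((- (real j + l) / \<nu>) gchoose r) * c powr (- real r) *
                (LINT \<Omega>|surface_measure. G (j - m) \<Omega> * comp_sum F m r \<Omega>)))"

end

theory Submission
  imports Defs
begin

text \<open>
  Write \<open>\<rho> = |x|\<close>, \<open>\<Omega> = x/\<rho>\<close>, \<open>d\<close> for the dimension, \<open>\<phi> = \<rho>\<^sup>-\<^sup>\<nu> f\<close> and \<open>\<gamma> = \<rho>\<^sup>d\<^sup>-\<^sup>l g\<close>, so that the
  hypotheses are expansions of \<open>\<phi>\<close> and \<open>\<gamma>\<close> in powers of \<open>\<rho>\<close>, uniform in \<open>\<Omega>\<close>.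

  Outside a ball around the origin \<open>f\<close> is bounded below by some \<open>m > 0\<close>, so this part of the integral
  is \<open>O(exp (- m k))\<close>. Inside the ball put \<open>t = k \<rho>\<^sup>\<nu>\<close>; the integrand is \<open>\<rho>\<^sup>l\<^sup>-\<^sup>d exp (- t \<phi>) \<gamma>\<close>. The limit
  of \<open>\<phi>\<close> at the origin is the constant \<open>c\<close>, so a factor \<open>exp (- c t)\<close> independent of the direction splits
  off, and \<open>exp (- t (\<phi> - c)) \<gamma>\<close> has a formal expansion in powers of \<open>\<rho>\<close> whose coefficients are
  polynomials in \<open>t\<close> with coefficients depending on \<open>\<Omega>\<close>. Its truncation after \<open>\<rho>\<^sup>N\<close> is \<open>laplace_model\<close>.

  The truncated expansion is a finite sum of functions \<open>\<rho>\<^sup>a\<^sup>-\<^sup>d exp (- c k \<rho>\<^sup>\<nu>) w(\<Omega>)\<close>. Polar coordinates and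
  the substitution \<open>s = c k \<rho>\<^sup>\<nu>\<close> turn the integral of each of them over the whole space into a value of
  the Gamma function times the integral of \<open>w\<close> over the sphere, and the identity
  \<open>(-1)\<^sup>r \<Gamma>(\<alpha> + r) / r! = \<Gamma>(\<alpha>) (-\<alpha> choose r)\<close> makes the total equal to
  \<open>\<Sum>\<^sub>j \<zeta>\<^sub>j k powr (- (j + l) / \<nu>)\<close> exactly (\<open>has_bochner_integral_laplace_model\<close>).

  The truncation error is at most \<open>C (\<eta> + \<rho>) \<rho>\<^sup>N exp (- c t / 4) (1 + \<Sum>\<^sub>j |G\<^sub>j(\<Omega>)|)\<close> when the expansions of
  \<open>\<phi>\<close> and \<open>\<gamma>\<close> hold up to \<open>\<eta> \<rho>\<^sup>N\<close> (\<open>laplace_model_local\<close>). This bound is again of product form, so its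
  integral against \<open>\<rho>\<^sup>l\<^sup>-\<^sup>d\<close> over a ball of radius \<open>\<eta>\<close> is at most a constant times
  \<open>\<eta> k powr (- (N + l) / \<nu>)\<close>, with \<open>\<eta>\<close> as small as desired. Beyond the ball the truncated expansion is
  itself exponentially small (\<open>laplace_model_tail\<close>).

  The coefficients \<open>G\<^sub>j\<close> are at first arbitrary functions. Each is a pointwise limit of rescaled
  values of \<open>g\<close>, hence \<open>x \<mapsto> G\<^sub>j(x/|x|)\<close> is Lebesgue measurable, and this is enough for measurability on
  the sphere (\<open>borel_measurable_surface_measureI\<close>). The function \<open>\<Sum>\<^sub>j G\<^sub>j(x/|x|) |x|\<^sup>j\<^sup>+\<^sup>l\<^sup>-\<^sup>d\<close> is integrable near the
  origin because \<open>g\<close> is; its summands are homogeneous of different degrees, and comparing the sum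
  with its own rescaling by \<open>1/2\<close> removes any one of them. Repeating this isolates each \<open>G\<^sub>j\<close>
  (\<open>homogeneous_components_integrable\<close>).
\<close>

section \<open>Polar coordinates for Lebesgue measure\<close>

text \<open>
  The Borel measure whose completion is \<open>surface_measure\<close>. Products and pushforwards are formed with
  this one, and null sets are added afterwards.
\<close>

definition sphere_borel :: "'a::euclidean_space measure" where
  "sphere_borel =
     scale_measure (of_nat DIM('a))
       (distr (restrict_space lborel (cball 0 1 - {0}))
              (restrict_space borel (sphere 0 1))
              (\<lambda>x. x /\<^sub>R norm x))"

lemma surface_measure_eq_completion: "surface_measure = completion sphere_borel"
  by (simp add: surface_measure_def sphere_borel_def)

lemma sets_sphere_borel [measurable_cong, simp]:
  "sets sphere_borel = sets (restrict_space borel (sphere 0 1))"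
  by (simp add: sphere_borel_def sets_scale_measure)

lemma space_sphere_borel [simp]: "space sphere_borel = sphere 0 1"
  by (simp add: sphere_borel_def space_scale_measure space_restrict_space)

lemma sets_sphere_borel_iff: "A \<in> sets sphere_borel \<longleftrightarrow> A \<in> sets borel \<and> A \<subseteq> sphere 0 1"
  by (simp, subst sets_restrict_space_iff) auto

lemma emeasure_sphere_borel:
  fixes A :: "'a::euclidean_space set"
  assumes "A \<in> sets sphere_borel"
  shows "emeasure sphere_borel A =
           of_nat DIM('a) * emeasure lborel {x \<in> cball 0 1 - {0}. x /\<^sub>R norm x \<in> A}"
  using emeasure_surface_measure[of A] assms
  by (simp add: surface_measure_eq_completion emeasure_completion sets_sphere_borel_iff
      del: sets_sphere_borel)

lemma direction_vimage_borel:
  fixes A :: "'a::euclidean_space set"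
  assumes "A \<in> sets borel" "B \<in> sets borel"
  shows "{x \<in> B - {0}. x /\<^sub>R norm x \<in> A} \<in> sets borel"
proof -
  have "(\<lambda>x::'a. x /\<^sub>R norm x) -` A \<inter> space borel \<in> sets borel"
    by (rule measurable_sets[OF _ assms(1)]) measurable
  moreover have "{x \<in> B - {0}. x /\<^sub>R norm x \<in> A} = (B - {0}) \<inter> ((\<lambda>x. x /\<^sub>R norm x) -` A \<inter> space borel)"
    by auto
  ultimately show ?thesis using assms(2) by auto
qed

lemma finite_measure_sphere_borel: "finite_measure (sphere_borel :: 'a::euclidean_space measure)"
proof
  have "sphere 0 1 \<in> sets (sphere_borel :: 'a measure)"
    by (simp add: sets_sphere_borel_iff del: sets_sphere_borel)
  then have "emeasure sphere_borel (sphere (0::'a) 1) \<le>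
      of_nat DIM('a) * emeasure lborel (cball (0::'a) 1)"
    by (subst emeasure_sphere_borel, assumption, intro mult_left_mono emeasure_mono) auto
  also have "\<dots> < \<infinity>"
    using emeasure_bounded_finite[of "cball (0::'a) 1"]
    by (simp add: ennreal_mult_less_top of_nat_less_top)
  finally show "emeasure (sphere_borel :: 'a measure) (space sphere_borel) \<noteq> \<infinity>"
    by simp
qed

text \<open>
  The truncated cone of height \<open>b\<close> is the truncated cone of height \<open>1\<close> scaled by \<open>b\<close>, and Lebesgue
  measure is homogeneous of degree equal to the dimension. This is where the radial density comes from.
\<close>

lemma emeasure_truncated_cone:
  fixes A :: "'a::euclidean_space set"
  assumes A: "A \<in> sets sphere_borel" and b: "0 \<le> b"
  shows "of_nat DIM('a) * emeasure lborel {x \<in> cball 0 b - {0}. x /\<^sub>R norm x \<in> A} =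
           ennreal (b ^ DIM('a)) * emeasure sphere_borel A"
proof (cases "b = 0")
  case True
  then show ?thesis by simp
next
  case False
  with b have b: "b > 0" by simp
  let ?C = "\<lambda>b. {x \<in> cball (0::'a) b - {0}. x /\<^sub>R norm x \<in> A}"
  have AB: "A \<in> sets borel" using A by (simp add: sets_sphere_borel_iff del: sets_sphere_borel)
  have C: "?C b \<in> sets borel" for b
    by (rule direction_vimage_borel[OF AB]) auto
  have "?C b = (\<lambda>x. 0 + b *\<^sub>R x) ` ?C 1"
  proof (intro equalityI subsetI)
    fix x assume x: "x \<in> ?C b"
    \<comment> \<open>Scaling a point does not change its direction.\<close>
    have "x /\<^sub>R b \<in> ?C 1"
      using x b by (auto simp: field_simps)
    moreover have "x = 0 + b *\<^sub>R (x /\<^sub>R b)" using b by simp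
    ultimately show "x \<in> (\<lambda>x. 0 + b *\<^sub>R x) ` ?C 1" by blast
  next
    fix x assume "x \<in> (\<lambda>x. 0 + b *\<^sub>R x) ` ?C 1"
    then obtain y where y: "x = b *\<^sub>R y" "y \<in> ?C 1" by auto
    have "inverse b * inverse (norm y) * b = inverse (norm y)" using b by simp
    then have "x /\<^sub>R norm x = y /\<^sub>R norm y" using y(1) b by simp
    with y(2) have "x /\<^sub>R norm x \<in> A" by auto
    moreover have "x \<in> cball 0 b - {0}" using y b by (auto simp: mult_le_cancel_left1)
    ultimately show "x \<in> ?C b" by blast
  qed
  then have "emeasure lebesgue (?C b) = ennreal (b ^ DIM('a)) * emeasure lebesgue (?C 1)"
    using emeasure_lebesgue_affine[of b "0::'a" "?C 1"] b
    by (simp add: ennreal_power)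
  then have "emeasure lborel (?C b) = ennreal (b ^ DIM('a)) * emeasure lborel (?C 1)"
    using C by simp
  then show ?thesis
    using A by (simp only: emeasure_sphere_borel mult_ac)
qed

text \<open>
  The radial factor \<open>\<rho>\<^sup>d\<^sup>-\<^sup>1 d\<rho>\<close> of Lebesgue measure in polar coordinates. The argument only serves to
  carry the dimension.
\<close>

definition radius_measure :: "'a::euclidean_space itself \<Rightarrow> real measure" where
  "radius_measure _ = density lborel (\<lambda>\<rho>. indicator {0<..} \<rho> * ennreal (\<rho> ^ (DIM('a) - 1)))"

lemma sets_radius_measure [measurable_cong, simp]: "sets (radius_measure t) = sets borel"
  and space_radius_measure [simp]: "space (radius_measure t) = UNIV"
  by (simp_all add: radius_measure_def)

lemma emeasure_radius_measure_atMost: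
  "of_nat DIM('a::euclidean_space) * emeasure (radius_measure TYPE('a)) {..b} =
     ennreal (max 0 b ^ DIM('a))"
proof -
  let ?b = "max 0 b" and ?d = "DIM('a)"
  have "emeasure (radius_measure TYPE('a)) {..b} =
      (\<integral>\<^sup>+\<rho>. indicator {0<..} \<rho> * ennreal (\<rho> ^ (?d - 1)) * indicator {..b} \<rho> \<partial>lborel)"
    unfolding radius_measure_def by (subst emeasure_density) auto
  also have "\<dots> = (\<integral>\<^sup>+\<rho>. ennreal (\<rho> ^ (?d - 1)) * indicator {0..?b} \<rho> \<partial>lborel)"
  proof (rule nn_integral_cong_AE)
    show "AE \<rho> in lborel. indicator {0<..} \<rho> * ennreal (\<rho> ^ (?d - 1)) * indicator {..b} \<rho> =
        ennreal (\<rho> ^ (?d - 1)) * indicator {0..?b} \<rho>"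
      using AE_lborel_singleton[of 0] by eventually_elim (auto split: split_indicator)
  qed
  also have "\<dots> = ennreal (?b ^ ?d / ?d - 0 ^ ?d / ?d)"
    by (rule nn_integral_FTC_Icc)
       (auto intro!: derivative_eq_intros simp: field_simps)
  also have "\<dots> = ennreal (?b ^ ?d / ?d)" by (simp add: power_0_left)
  finally have "emeasure (radius_measure TYPE('a)) {..b} = ennreal (?b ^ ?d / ?d)" .
  then show ?thesis
    by (simp only: ennreal_of_nat_eq_real_of_nat ennreal_mult[symmetric] of_nat_0_le_iff
        divide_nonneg_nonneg zero_le_power max.cobounded1) simp
qed

lemma emeasure_radius_measure_finite: "emeasure (radius_measure TYPE('a::euclidean_space)) {..b} < top"
proof -
  have "of_nat DIM('a) * emeasure (radius_measure TYPE('a)) {..b} < top"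
    by (simp only: emeasure_radius_measure_atMost ennreal_less_top)
  then show ?thesis by (auto simp: ennreal_mult_less_top)
qed

text \<open>
  For fixed \<open>A\<close> both sides are measures in \<open>B\<close>. They agree, and are finite, on the intervals \<open>{..b}\<close>,
  which give truncated cones; these intervals are stable under intersection and generate the
  Borel sets of the line.
\<close>

lemma emeasure_polar_rectangle:
  fixes A :: "'a::euclidean_space set"
  assumes A: "A \<in> sets sphere_borel" and B: "B \<in> sets borel"
  shows "emeasure (radius_measure TYPE('a)) B * emeasure sphere_borel A =
           emeasure lborel {x \<in> -{0}. norm x \<in> B \<and> x /\<^sub>R norm x \<in> A}"
proof -
  let ?d = "of_nat DIM('a) :: ennreal" and ?C = "{x \<in> UNIV - {0}. x /\<^sub>R norm x \<in> A}"
  define M where "M = distr (restrict_space lborel ?C) borel (norm :: 'a \<Rightarrow> real)"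
  define M' where "M' = scale_measure (emeasure sphere_borel A) (radius_measure TYPE('a))"
  interpret finite_measure "sphere_borel :: 'a measure" by (rule finite_measure_sphere_borel)
  have AB: "A \<in> sets borel" using A by (simp add: sets_sphere_borel_iff del: sets_sphere_borel)
  have C: "?C \<in> sets borel" by (rule direction_vimage_borel[OF AB]) simp
  have nm: "norm \<in> measurable (restrict_space lborel ?C) borel"
    by (intro measurable_restrict_space1) simp
  have eM: "emeasure M X = emeasure lborel {x \<in> -{0}. norm x \<in> X \<and> x /\<^sub>R norm x \<in> A}"
    if "X \<in> sets borel" for X
    unfolding M_def using that C
    apply (subst emeasure_distr[OF nm], simp)
    apply (subst emeasure_restrict_space)
      apply (auto simp: space_restrict_space intro!: arg_cong[where f = "emeasure lborel"])
    done
  have eM': "emeasure M' X = emeasure (radius_measure TYPE('a)) X * emeasure sphere_borel A" for X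
    unfolding M'_def by (simp add: mult.commute)
  have d0: "?d \<noteq> 0" "?d \<noteq> top" by auto
  have eq: "emeasure M {..b} = emeasure M' {..b}" for b
  proof -
    \<comment> \<open>For negative \<open>b\<close> both sets are empty, which the height \<open>max 0 b = 0\<close> reproduces.\<close>
    have "?d * emeasure M {..b} = ?d * emeasure lborel {x \<in> cball 0 (max 0 b) - {0}. x /\<^sub>R norm x \<in> A}"
      by (subst eM, simp, rule arg_cong[where f = "\<lambda>S. ?d * emeasure lborel S"]) (auto simp: max_def intro: order.trans[OF norm_ge_zero])
    also have "\<dots> = ennreal (max 0 b ^ DIM('a)) * emeasure sphere_borel A"
      by (rule emeasure_truncated_cone[OF A]) simp
    also have "\<dots> = ?d * emeasure M' {..b}"
      by (simp only: eM' emeasure_radius_measure_atMost[symmetric] mult.assoc)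
    finally show ?thesis using d0 by (simp add: ennreal_mult_cancel_left)
  qed
  have fin: "emeasure M' {..b} \<noteq> \<infinity>" for b
  proof -
    have "emeasure sphere_borel A < top" by (rule less_top[THEN iffD1]) simp
    then show ?thesis using emeasure_radius_measure_finite[where 'a = 'a, of b]
      unfolding eM' by (simp add: ennreal_mult_eq_top_iff)
  qed
  have "M = M'"
  proof (rule measure_eqI_generator_eq[where \<Omega> = UNIV and E = "range (\<lambda>a::real. {..a})"
        and A = "\<lambda>n. {..real n}"])
    show "Int_stable (range (\<lambda>a::real. {..a}))"
      by (auto simp: Int_stable_def intro!: image_eqI[where x = "min _ _"])
    show "sets M = sigma_sets UNIV (range (\<lambda>a::real. {..a}))"
      "sets M' = sigma_sets UNIV (range (\<lambda>a::real. {..a}))"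
      by (simp_all add: M_def M'_def sets_scale_measure borel_eq_atMost)
    show "(\<Union>i. {..real i}) = UNIV" by (auto intro: real_arch_simple)
    show "emeasure M {..real i} \<noteq> \<infinity>" for i using fin eq by simp
  qed (use eq in auto)
  then show ?thesis using eM[OF B] eM' by simp
qed

lemma direction_measurable_borel:
  "(\<lambda>x::'a::euclidean_space. x /\<^sub>R norm x) \<in> measurable (restrict_space lborel (-{0})) sphere_borel"
  by (subst measurable_cong_sets[OF refl sets_sphere_borel], rule measurable_restrict_space2)
     (auto simp: space_restrict_space intro!: measurable_restrict_space1)

text \<open>
  A measure on a product of two \<open>\<sigma>\<close>-finite spaces is determined by its values on rectangles.
\<close>

theorem lborel_polar_coordinates:
  "distr (restrict_space lborel (-{0})) (borel \<Otimes>\<^sub>M sphere_borel) (\<lambda>x::'a. (norm x, x /\<^sub>R norm x)) =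
     radius_measure TYPE('a::euclidean_space) \<Otimes>\<^sub>M sphere_borel" (is "?D = ?P")
proof (rule sym, rule pair_measure_eqI)
  show "sigma_finite_measure (radius_measure TYPE('a))"
  proof
    have "(\<Union>n. {..real n}) = UNIV" by (auto intro: real_arch_simple)
    then show "\<exists>A. countable A \<and> A \<subseteq> sets (radius_measure TYPE('a)) \<and>
        \<Union> A = space (radius_measure TYPE('a)) \<and> (\<forall>a\<in>A. emeasure (radius_measure TYPE('a)) a \<noteq> \<infinity>)"
      using emeasure_radius_measure_finite[where 'a = 'a]
      by (intro exI[of _ "range (\<lambda>n. {..real n})"]) (auto simp: less_top)
  qed
  interpret finite_measure "sphere_borel :: 'a measure" by (rule finite_measure_sphere_borel)
  show "sigma_finite_measure (sphere_borel :: 'a measure)" ..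
  show "sets (radius_measure TYPE('a) \<Otimes>\<^sub>M sphere_borel) = sets ?D"
    by (simp cong: sets_pair_measure_cong)
  have m: "(\<lambda>x::'a. (norm x, x /\<^sub>R norm x)) \<in> measurable (restrict_space lborel (-{0})) (borel \<Otimes>\<^sub>M sphere_borel)"
    by (intro measurable_Pair direction_measurable_borel measurable_restrict_space1) simp
  fix B :: "real set" and A :: "'a set"
  assume "B \<in> sets (radius_measure TYPE('a))" and A: "A \<in> sets sphere_borel"
  then have B: "B \<in> sets borel" by simp
  have "emeasure ?D (B \<times> A) = emeasure lborel {x \<in> -{0}. norm x \<in> B \<and> x /\<^sub>R norm x \<in> A}"
    using A B
    apply (subst emeasure_distr[OF m], simp)
    apply (subst emeasure_restrict_space)
      apply (auto simp: space_restrict_space intro!: arg_cong[where f = "emeasure lborel"])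
    done
  then show "emeasure (radius_measure TYPE('a)) B * emeasure sphere_borel A = emeasure ?D (B \<times> A)"
    using emeasure_polar_rectangle[OF A B] by simp
qed

lemma nn_integral_radial_times_angular_borel:
  fixes w :: "'a::euclidean_space \<Rightarrow> ennreal"
  assumes h [measurable]: "h \<in> borel_measurable borel" and w [measurable]: "w \<in> borel_measurable sphere_borel"
  shows "(\<integral>\<^sup>+x. h (norm x) * w (x /\<^sub>R norm x) * indicator (-{0}) x \<partial>lborel) =
           (\<integral>\<^sup>+\<rho>. h \<rho> \<partial>radius_measure TYPE('a)) * (\<integral>\<^sup>+\<Omega>. w \<Omega> \<partial>sphere_borel)"
proof -
  interpret finite_measure "sphere_borel :: 'a measure" by (rule finite_measure_sphere_borel)
  let ?g = "\<lambda>(\<rho>, \<Omega>). h \<rho> * w \<Omega>"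
  have m: "(\<lambda>x::'a. (norm x, x /\<^sub>R norm x)) \<in> measurable (restrict_space lborel (-{0})) (borel \<Otimes>\<^sub>M sphere_borel)"
    by (intro measurable_Pair direction_measurable_borel measurable_restrict_space1) simp
  have "(\<integral>\<^sup>+x. h (norm x) * w (x /\<^sub>R norm x) * indicator (-{0}) x \<partial>lborel) =
      (\<integral>\<^sup>+x. ?g (norm x, x /\<^sub>R norm x) \<partial>restrict_space lborel (-{0}))"
    by (subst nn_integral_restrict_space) auto
  also have "\<dots> = (\<integral>\<^sup>+p. ?g p \<partial>distr (restrict_space lborel (-{0})) (borel \<Otimes>\<^sub>M sphere_borel)
        (\<lambda>x::'a. (norm x, x /\<^sub>R norm x)))"
    by (rule nn_integral_distr[OF m, symmetric]) measurable
  also have "\<dots> = (\<integral>\<^sup>+p. ?g p \<partial>(radius_measure TYPE('a) \<Otimes>\<^sub>M sphere_borel))"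
    by (simp only: lborel_polar_coordinates)
  also have "\<dots> = (\<integral>\<^sup>+\<rho>. (\<integral>\<^sup>+\<Omega>. h \<rho> * w \<Omega> \<partial>sphere_borel) \<partial>radius_measure TYPE('a))"
    by (subst nn_integral_fst[symmetric]) auto
  also have "\<dots> = (\<integral>\<^sup>+\<rho>. h \<rho> \<partial>radius_measure TYPE('a)) * (\<integral>\<^sup>+\<Omega>. w \<Omega> \<partial>sphere_borel)"
    by (simp add: nn_integral_cmult nn_integral_multc)
  finally show ?thesis .
qed

section \<open>Integrals of products of a radial and an angular function\<close>

text \<open>
  This carries statements that hold almost everywhere, and hence completions, from the sphere to
  the space and back.
\<close>

lemma null_cone_iff:
  fixes A :: "'a::euclidean_space set"
  assumes A: "A \<in> sets sphere_borel"
  shows "{x \<in> -{0}. x /\<^sub>R norm x \<in> A} \<in> null_sets lborel \<longleftrightarrow> A \<in> null_sets sphere_borel"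
proof -
  have AB: "A \<in> sets borel" using A by (simp add: sets_sphere_borel_iff del: sets_sphere_borel)
  have C: "{x \<in> B - {0}. x /\<^sub>R norm x \<in> A} \<in> sets borel" if "B \<in> sets borel" for B
    by (rule direction_vimage_borel[OF AB that])
  have C1: "{x \<in> -{0}. x /\<^sub>R norm x \<in> A} \<in> sets borel"
    using C[of UNIV] by (simp add: Compl_eq_Diff_UNIV)
  show ?thesis
  proof
    assume "{x \<in> -{0}. x /\<^sub>R norm x \<in> A} \<in> null_sets lborel"
    then have "{x \<in> cball 0 1 - {0}. x /\<^sub>R norm x \<in> A} \<in> null_sets lborel"
      by (rule null_sets_subset) (use C[of "cball 0 1"] in auto)
    then have "emeasure lborel {x \<in> cball 0 1 - {0}. x /\<^sub>R norm x \<in> A} = 0" by auto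
    then show "A \<in> null_sets sphere_borel"
      using A by (intro null_setsI) (simp_all only: emeasure_sphere_borel mult_zero_right)
  next
    assume "A \<in> null_sets sphere_borel"
    moreover have "emeasure lborel {x \<in> -{0}. norm x \<in> UNIV \<and> x /\<^sub>R norm x \<in> A} =
        emeasure (radius_measure TYPE('a)) UNIV * emeasure sphere_borel A"
      by (rule emeasure_polar_rectangle[OF A, symmetric]) simp
    ultimately show "{x \<in> -{0}. x /\<^sub>R norm x \<in> A} \<in> null_sets lborel"
      using C1 by (intro null_setsI) auto
  qed
qed

lemma AE_direction:
  assumes "AE \<Omega> in sphere_borel. P \<Omega>"
  shows "AE x in lborel. x \<noteq> (0::'a::euclidean_space) \<longrightarrow> P (x /\<^sub>R norm x)"
proof -
  obtain A where A: "\<And>\<Omega>. \<Omega> \<in> space sphere_borel - A \<Longrightarrow> P \<Omega>" "A \<in> null_sets sphere_borel"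
    using AE_E3[OF assms] by blast
  then have "{x \<in> -{0}. x /\<^sub>R norm x \<in> A} \<in> null_sets lborel"
    using null_cone_iff[of A] by blast
  moreover have "{x \<in> space lborel. \<not> (x \<noteq> 0 \<longrightarrow> P (x /\<^sub>R norm x))} \<subseteq>
      {x \<in> -{0}. x /\<^sub>R norm x \<in> A}"
    using A(1) by force
  ultimately show ?thesis by (rule AE_I')
qed

lemma direction_measurable:
  "(\<lambda>x::'a::euclidean_space. x /\<^sub>R norm x) \<in> measurable (lebesgue_on (-{0})) surface_measure"
proof (rule measurableI)
  fix x :: 'a
  assume "x \<in> space (lebesgue_on (-{0}))"
  then show "x /\<^sub>R norm x \<in> space surface_measure" by auto
next
  fix A :: "'a set"
  assume "A \<in> sets surface_measure"
  then obtain S N N' where A: "A = S \<union> N" "N \<subseteq> N'" "N' \<in> null_sets sphere_borel" "S \<in> sets sphere_borel"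
    unfolding surface_measure_eq_completion by (elim sets_completionE)
  let ?C = "\<lambda>A. {x \<in> -{0}. x /\<^sub>R norm x \<in> A}"
  have "S \<in> sets borel" using A(4) unfolding sets_sphere_borel_iff by blast
  from direction_vimage_borel[OF this, of UNIV] have "?C S \<in> sets borel"
    by (simp add: Compl_eq_Diff_UNIV)
  moreover have "?C N' \<in> null_sets lborel"
    using null_cone_iff[of N'] A(3) by blast
  then have "?C N \<in> sets lebesgue"
    by (rule null_sets_completion) (use A(2) in auto)
  ultimately have "?C S \<union> ?C N \<in> sets lebesgue" by (intro sets.Un) auto
  moreover have "?C S \<union> ?C N = (\<lambda>x. x /\<^sub>R norm x) -` A \<inter> space (lebesgue_on (-{0}))"
    using A(1) by auto
  ultimately show "(\<lambda>x. x /\<^sub>R norm x) -` A \<inter> space (lebesgue_on (-{0})) \<in> sets (lebesgue_on (-{0}))"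
    by (subst sets_restrict_space_iff) auto
qed

text \<open>
  The condition \<open>h 0 = 0\<close> makes the product vanish at the origin, where \<open>x /\<^sub>R norm x\<close> is not a
  direction.
\<close>

lemma radial_times_angular_measurable:
  fixes w :: "'a::euclidean_space \<Rightarrow> real"
  assumes h: "h \<in> borel_measurable borel" "h 0 = 0" and w: "w \<in> borel_measurable surface_measure"
  shows "(\<lambda>x. h (norm x) * w (x /\<^sub>R norm x)) \<in> borel_measurable lebesgue"
proof -
  have "(\<lambda>x::'a. norm x) \<in> borel_measurable (lebesgue_on (-{0}))"
    by (intro measurable_restrict_space1 measurable_completion) simp
  then have "(\<lambda>x. h (norm x) * w (x /\<^sub>R norm x)) \<in> borel_measurable (lebesgue_on (-{0}))"
    by (intro borel_measurable_times measurable_compose[OF _ h(1)]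
        measurable_compose[OF direction_measurable w])
  then have "(\<lambda>x. if x \<in> -{0} then h (norm x) * w (x /\<^sub>R norm x) else 0) \<in> borel_measurable lebesgue"
    by (rule borel_measurable_if_I) auto
  also have "(\<lambda>x. if x \<in> -{0} then h (norm x) * w (x /\<^sub>R norm x) else 0) =
      (\<lambda>x. h (norm x) * w (x /\<^sub>R norm x))"
    using h(2) by auto
  finally show ?thesis .
qed

text \<open>
  After replacing \<open>w\<close> by a Borel function that agrees with it almost everywhere this is Tonelli's
  theorem in polar coordinates.
\<close>

lemma nn_integral_radial_times_angular:
  fixes w :: "'a::euclidean_space \<Rightarrow> real"
  assumes h: "h \<in> borel_measurable borel" "h 0 = 0" "\<And>\<rho>. 0 \<le> h \<rho>"
    and w: "w \<in> borel_measurable surface_measure" "\<And>\<Omega>. 0 \<le> w \<Omega>"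
  shows "(\<integral>\<^sup>+x. ennreal (h (norm x) * w (x /\<^sub>R norm x)) \<partial>lebesgue) =
           (\<integral>\<^sup>+\<rho>. ennreal (h \<rho>) \<partial>radius_measure TYPE('a)) * (\<integral>\<^sup>+\<Omega>. ennreal (w \<Omega>) \<partial>surface_measure)"
proof -
  obtain w' where w': "w' \<in> borel_measurable sphere_borel" "AE \<Omega> in sphere_borel. ennreal (w \<Omega>) = w' \<Omega>"
    using completion_ex_borel_measurable[of "\<lambda>\<Omega>. ennreal (w \<Omega>)" sphere_borel] w(1)
    by (auto simp: surface_measure_eq_completion)
  have "(\<integral>\<^sup>+x. ennreal (h (norm x) * w (x /\<^sub>R norm x)) \<partial>lebesgue) =
      (\<integral>\<^sup>+x. ennreal (h (norm x) * w (x /\<^sub>R norm x)) \<partial>lborel)"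
    by (rule nn_integral_completion)
  also have "\<dots> = (\<integral>\<^sup>+x. ennreal (h (norm x)) * w' (x /\<^sub>R norm x) * indicator (-{0}) x \<partial>lborel)"
  proof (rule nn_integral_cong_AE)
    show "AE x in lborel. ennreal (h (norm x) * w (x /\<^sub>R norm x)) =
        ennreal (h (norm x)) * w' (x /\<^sub>R norm x) * indicator (-{0}) x"
      using AE_direction[OF w'(2)]
      by eventually_elim (use h w(2) in \<open>auto simp: ennreal_mult split: split_indicator\<close>)
  qed
  also have "\<dots> = (\<integral>\<^sup>+\<rho>. ennreal (h \<rho>) \<partial>radius_measure TYPE('a)) * (\<integral>\<^sup>+\<Omega>. w' \<Omega> \<partial>sphere_borel)"
    by (rule nn_integral_radial_times_angular_borel) (use h w' in auto)
  also have "(\<integral>\<^sup>+\<Omega>. w' \<Omega> \<partial>sphere_borel) = (\<integral>\<^sup>+\<Omega>. ennreal (w \<Omega>) \<partial>surface_measure)"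
    unfolding surface_measure_eq_completion nn_integral_completion
    by (rule nn_integral_cong_AE) (use w'(2) in auto)
  finally show ?thesis .
qed

lemma has_bochner_integral_radial_times_angular:
  fixes w :: "'a::euclidean_space \<Rightarrow> real"
  assumes h: "h \<in> borel_measurable borel" "h 0 = 0" "\<And>\<rho>. 0 \<le> h \<rho>"
    and H: "(\<integral>\<^sup>+\<rho>. ennreal (h \<rho>) \<partial>radius_measure TYPE('a)) = ennreal H" "0 \<le> H"
    and w: "integrable surface_measure w"
  shows "has_bochner_integral lebesgue (\<lambda>x. h (norm x) * w (x /\<^sub>R norm x))
           (H * integral\<^sup>L surface_measure w)"
proof -
  have nonneg: "has_bochner_integral lebesgue (\<lambda>x. h (norm x) * v (x /\<^sub>R norm x))
      (H * integral\<^sup>L surface_measure v)"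
    if v: "integrable surface_measure v" "\<And>\<Omega>. 0 \<le> v \<Omega>" for v :: "'a \<Rightarrow> real"
  proof (rule has_bochner_integral_nn_integral)
    have [measurable]: "v \<in> borel_measurable surface_measure" using v(1) by simp
    show "(\<lambda>x. h (norm x) * v (x /\<^sub>R norm x)) \<in> borel_measurable lebesgue"
      using h by (intro radial_times_angular_measurable) auto
    have "(\<integral>\<^sup>+x. ennreal (h (norm x) * v (x /\<^sub>R norm x)) \<partial>lebesgue) =
        ennreal H * (\<integral>\<^sup>+\<Omega>. ennreal (v \<Omega>) \<partial>surface_measure)"
      unfolding H(1)[symmetric]
      by (rule nn_integral_radial_times_angular[OF h]) (use v in auto)
    also have "(\<integral>\<^sup>+\<Omega>. ennreal (v \<Omega>) \<partial>surface_measure) = ennreal (integral\<^sup>L surface_measure v)"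
      by (rule nn_integral_eq_integral[OF v(1)]) (simp add: v(2))
    also have "ennreal H * \<dots> = ennreal (H * integral\<^sup>L surface_measure v)"
      by (rule ennreal_mult[symmetric, OF H(2)]) (simp add: v(2))
    finally show "(\<integral>\<^sup>+x. ennreal (h (norm x) * v (x /\<^sub>R norm x)) \<partial>lebesgue) =
        ennreal (H * integral\<^sup>L surface_measure v)" .
    show "AE x in lebesgue. 0 \<le> h (norm x) * v (x /\<^sub>R norm x)"
      by (intro always_eventually allI mult_nonneg_nonneg h(3) v(2))
    show "0 \<le> H * integral\<^sup>L surface_measure v"
      by (intro mult_nonneg_nonneg H(2) Bochner_Integration.integral_nonneg v(2))
  qed
  have "has_bochner_integral lebesgue
      (\<lambda>x. h (norm x) * max 0 (w (x /\<^sub>R norm x)) - h (norm x) * max 0 (- w (x /\<^sub>R norm x)))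
      (H * (LINT \<Omega>|surface_measure. max 0 (w \<Omega>)) - H * (LINT \<Omega>|surface_measure. max 0 (- w \<Omega>)))"
    using w by (intro has_bochner_integral_diff nonneg) auto
  moreover have parts: "max 0 t - max 0 (- t) = t" for t :: real
    by (simp add: max_def)
  moreover have "integral\<^sup>L surface_measure w =
      (LINT \<Omega>|surface_measure. max 0 (w \<Omega>)) - (LINT \<Omega>|surface_measure. max 0 (- w \<Omega>))"
    using w by (subst Bochner_Integration.integral_diff[symmetric]) (auto simp: parts)
  ultimately show ?thesis
    by (simp only: right_diff_distrib[symmetric])
qed

text \<open>
  If the radial factor has a nonzero integral, finiteness of the product of the two integrals
  forces the angular integral to be finite.
\<close>

lemma integrable_angular:
  fixes w :: "'a::euclidean_space \<Rightarrow> real"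
  assumes h: "h \<in> borel_measurable borel" "h 0 = 0" "\<And>\<rho>. 0 \<le> h \<rho>"
    and H: "(\<integral>\<^sup>+\<rho>. ennreal (h \<rho>) \<partial>radius_measure TYPE('a)) \<noteq> 0"
    and w: "w \<in> borel_measurable surface_measure"
    and int: "integrable lebesgue (\<lambda>x. h (norm x) * w (x /\<^sub>R norm x))"
  shows "integrable surface_measure w"
proof -
  have "(\<integral>\<^sup>+\<rho>. ennreal (h \<rho>) \<partial>radius_measure TYPE('a)) * (\<integral>\<^sup>+\<Omega>. ennreal \<bar>w \<Omega>\<bar> \<partial>surface_measure) =
      (\<integral>\<^sup>+x. ennreal (h (norm x) * \<bar>w (x /\<^sub>R norm x)\<bar>) \<partial>lebesgue)"
    by (rule nn_integral_radial_times_angular[OF h, symmetric]) (use w in auto)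
  also have "\<dots> = (\<integral>\<^sup>+x. ennreal (norm (h (norm x) * w (x /\<^sub>R norm x))) \<partial>lebesgue)"
    using h(3) by (simp add: abs_mult)
  also have "\<dots> < \<infinity>"
    using int unfolding integrable_iff_bounded by blast
  finally have "(\<integral>\<^sup>+\<Omega>. ennreal \<bar>w \<Omega>\<bar> \<partial>surface_measure) < \<infinity>"
    using H by (simp only: ennreal_mult_less_top infinity_ennreal_def) (auto simp: less_top)
  then show ?thesis
    using w by (intro integrableI_bounded) simp_all
qed

text \<open>
  The substitution \<open>t = b \<rho>\<^sup>\<nu>\<close> in Euler's integral for \<open>\<Gamma>(a/\<nu>)\<close>.
\<close>

lemma has_integral_powr_exp_powr:
  fixes a b \<nu> :: real
  assumes "0 < a" "0 < b" "0 < \<nu>"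
  shows "((\<lambda>\<rho>. \<rho> powr (a - 1) * exp (- b * \<rho> powr \<nu>)) has_integral
           Gamma (a / \<nu>) * b powr (- a / \<nu>) / \<nu>) {0<..}"
proof -
  let ?f = "\<lambda>t. t powr (a / \<nu> - 1) / exp t" and ?g = "\<lambda>\<rho>. b * \<rho> powr \<nu>"
  have img: "?g ` {0<..} = {0<..}"
  proof (intro equalityI subsetI)
    fix t :: real assume "t \<in> {0<..}"
    then have "t = ?g ((t / b) powr (1 / \<nu>))" "(t / b) powr (1 / \<nu>) \<in> {0<..}"
      using assms by (simp_all add: powr_powr)
    then show "t \<in> ?g ` {0<..}" by blast
  qed (use assms in auto)
  have inj: "inj_on ?g {0<..}"
  proof (rule inj_onI)
    fix x y :: real
    assume xy: "x \<in> {0<..}" "y \<in> {0<..}" "?g x = ?g y"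
    then have "x powr \<nu> = y powr \<nu>" using assms by simp
    moreover have "x = (x powr \<nu>) powr (1 / \<nu>)" "y = (y powr \<nu>) powr (1 / \<nu>)"
      using xy(1,2) assms by (simp_all add: powr_powr)
    ultimately show "x = y" by metis
  qed
  have "(?f has_integral Gamma (a / \<nu>)) {0<..}"
    using Gamma_integral_real[of "a / \<nu>"] assms
    by (subst has_integral_spike_set_eq[of _ "{0..}"])
       (auto intro: negligible_subset[OF negligible_sing[of 0]])
  then have I: "?f absolutely_integrable_on {0<..}" "integral {0<..} ?f = Gamma (a / \<nu>)"
    by (auto intro!: nonnegative_absolutely_integrable_1 simp: has_integral_iff)
  have "(\<lambda>\<rho>. \<bar>b * (\<nu> * \<rho> powr (\<nu> - 1))\<bar> * ?f (?g \<rho>)) absolutely_integrable_on {0<..} \<and>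
      integral {0<..} (\<lambda>\<rho>. \<bar>b * (\<nu> * \<rho> powr (\<nu> - 1))\<bar> * ?f (?g \<rho>)) = Gamma (a / \<nu>) \<longleftrightarrow>
      ?f absolutely_integrable_on (?g ` {0<..}) \<and> integral (?g ` {0<..}) ?f = Gamma (a / \<nu>)"
    by (rule has_absolute_integral_change_of_variables_1'[OF _ _ inj])
       (auto intro!: derivative_eq_intros)
  with I img have "((\<lambda>\<rho>. \<bar>b * (\<nu> * \<rho> powr (\<nu> - 1))\<bar> * ?f (?g \<rho>)) has_integral Gamma (a / \<nu>)) {0<..}"
    by (simp add: has_integral_iff absolutely_integrable_on_def)
  then have "((\<lambda>\<rho>. (b powr (- a / \<nu>) / \<nu>) * (\<bar>b * (\<nu> * \<rho> powr (\<nu> - 1))\<bar> * ?f (?g \<rho>)))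
      has_integral (b powr (- a / \<nu>) / \<nu>) * Gamma (a / \<nu>)) {0<..}"
    by (rule has_integral_mult_right)
  moreover have "(b powr (- a / \<nu>) / \<nu>) * (\<bar>b * (\<nu> * \<rho> powr (\<nu> - 1))\<bar> * ?f (?g \<rho>)) =
      \<rho> powr (a - 1) * exp (- b * \<rho> powr \<nu>)" if "\<rho> \<in> {0<..}" for \<rho>
  proof -
    have \<rho>: "\<rho> > 0" using that by simp
    have "?g \<rho> powr (a / \<nu> - 1) = b powr (a / \<nu> - 1) * \<rho> powr (a - \<nu>)"
      using \<rho> assms by (simp add: powr_mult powr_powr right_diff_distrib)
    moreover have "\<bar>b * (\<nu> * \<rho> powr (\<nu> - 1))\<bar> = b * \<nu> * \<rho> powr (\<nu> - 1)"
      using assms by (simp add: abs_mult)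
    ultimately have "(b powr (- a / \<nu>) / \<nu>) * (\<bar>b * (\<nu> * \<rho> powr (\<nu> - 1))\<bar> * ?f (?g \<rho>)) =
        (b powr (- a / \<nu>) * b powr 1 * b powr (a / \<nu> - 1)) * (\<rho> powr (\<nu> - 1) * \<rho> powr (a - \<nu>)) / exp (?g \<rho>)"
      using assms by (simp add: field_simps)
    also have "\<dots> = \<rho> powr (a - 1) * exp (- b * \<rho> powr \<nu>)"
      using assms by (simp only: powr_add[symmetric]) (simp add: exp_minus field_simps)
    finally show ?thesis .
  qed
  ultimately have "((\<lambda>\<rho>. \<rho> powr (a - 1) * exp (- b * \<rho> powr \<nu>)) has_integral
      (b powr (- a / \<nu>) / \<nu>) * Gamma (a / \<nu>)) {0<..}"
    by (rule has_integral_eq[rotated])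
  then show ?thesis by (simp add: mult.commute)
qed

lemma nn_integral_radius_powr_exp_powr:
  fixes a b \<nu> :: real
  assumes "0 < a" "0 < b" "0 < \<nu>"
  shows "(\<integral>\<^sup>+\<rho>. ennreal (\<rho> powr (a - real DIM('a)) * exp (- b * \<rho> powr \<nu>))
             \<partial>radius_measure TYPE('a::euclidean_space)) =
           ennreal (Gamma (a / \<nu>) * b powr (- a / \<nu>) / \<nu>)"
proof -
  let ?k = "\<lambda>\<rho>. \<rho> powr (a - 1) * exp (- b * \<rho> powr \<nu>)"
  have "(\<integral>\<^sup>+\<rho>. ennreal (\<rho> powr (a - real DIM('a)) * exp (- b * \<rho> powr \<nu>)) \<partial>radius_measure TYPE('a)) =
      (\<integral>\<^sup>+\<rho>. indicator {0<..} \<rho> * ennreal (\<rho> ^ (DIM('a) - 1)) *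
        ennreal (\<rho> powr (a - real DIM('a)) * exp (- b * \<rho> powr \<nu>)) \<partial>lborel)"
    unfolding radius_measure_def by (subst nn_integral_density) auto
  also have "\<dots> = (\<integral>\<^sup>+\<rho>. ennreal (indicator {0<..} \<rho> * ?k \<rho>) \<partial>lborel)"
  proof (rule nn_integral_cong)
    fix \<rho> :: real
    have "\<rho> ^ (DIM('a) - 1) * (\<rho> powr (a - real DIM('a)) * exp (- b * \<rho> powr \<nu>)) = ?k \<rho>" if "0 < \<rho>"
      using that by (simp add: powr_realpow[symmetric] powr_add[symmetric] of_nat_diff mult.assoc[symmetric])
    then show "indicator {0<..} \<rho> * ennreal (\<rho> ^ (DIM('a) - 1)) *
        ennreal (\<rho> powr (a - real DIM('a)) * exp (- b * \<rho> powr \<nu>)) = ennreal (indicator {0<..} \<rho> * ?k \<rho>)"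
      by (auto simp: ennreal_mult[symmetric] split: split_indicator)
  qed
  also have "\<dots> = ennreal (Gamma (a / \<nu>) * b powr (- a / \<nu>) / \<nu>)"
    using has_integral_powr_exp_powr[OF assms]
    by (intro nn_integral_has_integral_lebesgue) auto
  finally show ?thesis .
qed

text \<open>
  All integrals over the space that occur below, both in the main term and in the error bounds,
  are of this form.
\<close>

lemma has_bochner_integral_powr_exp_angular:
  fixes w :: "'a::euclidean_space \<Rightarrow> real"
  assumes "0 < a" "0 < b" "0 < \<nu>" and w: "integrable surface_measure w"
  shows "has_bochner_integral lebesgue
           (\<lambda>x. norm x powr (a - real DIM('a)) * exp (- b * norm x powr \<nu>) * w (x /\<^sub>R norm x))
           (Gamma (a / \<nu>) * b powr (- a / \<nu>) / \<nu> * integral\<^sup>L surface_measure w)"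
  using assms
  by (intro has_bochner_integral_radial_times_angular[OF _ _ _ nn_integral_radius_powr_exp_powr])
     (auto intro!: mult_nonneg_nonneg divide_nonneg_nonneg less_imp_le[OF Gamma_real_pos])

section \<open>Angular functions that are Lebesgue measurable on the whole space\<close>

text \<open>
  A Lebesgue measurable cone is the union of countably many compact sets and a null set. The compact
  sets avoid the origin, so their projections to the sphere are compact subsets of \<open>A\<close>, and the cone
  over the union \<open>B\<close> of these projections fills the given cone up to the null set.
\<close>

lemma cone_inner_borel:
  fixes A :: "'a::euclidean_space set"
  assumes A: "A \<subseteq> sphere 0 1" and cone: "{x \<in> -{0}. x /\<^sub>R norm x \<in> A} \<in> sets lebesgue"
  obtains B where "B \<in> sets sphere_borel" "B \<subseteq> A"
    "{x \<in> -{0}. x /\<^sub>R norm x \<in> A - B} \<in> null_sets lebesgue"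
proof -
  let ?E = "{x \<in> -{0}. x /\<^sub>R norm x \<in> A}"
  obtain C T where CT: "fsigma C" "T \<in> null_sets lebesgue" "C \<union> T = ?E" "disjnt C T"
    using lebesgue_set_almost_fsigma[OF cone] by blast
  obtain K :: "nat \<Rightarrow> 'a set" where "range K \<subseteq> Collect compact" and K2: "C = \<Union>(K ` UNIV)"
    using CT(1) unfolding fsigma_Union_compact by (elim exE conjE) 
  then have K1: "compact (K n)" for n by auto
  note K = K1 K2
  define B where "B = (\<Union>n. (\<lambda>x. x /\<^sub>R norm x) ` K n)"
  show ?thesis
  proof (rule that)
    show "B \<subseteq> A" using K(2) CT(3) unfolding B_def by blast
    have "(\<lambda>x. x /\<^sub>R norm x) ` K n \<in> sets borel" for n
    proof -
      have "0 \<notin> K n" using K(2) CT(3) by blast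
      then have "continuous_on (K n) (\<lambda>x. x /\<^sub>R norm x)"
        by (auto intro!: continuous_intros)
      then show ?thesis
        by (intro borel_closed compact_imp_closed compact_continuous_image K)
    qed
    then have "B \<in> sets borel" unfolding B_def by auto
    with \<open>B \<subseteq> A\<close> A show "B \<in> sets sphere_borel"
      unfolding sets_sphere_borel_iff by auto
    have "{x \<in> -{0}. x /\<^sub>R norm x \<in> A - B} \<subseteq> T"
    proof
      fix x assume x: "x \<in> {x \<in> -{0}. x /\<^sub>R norm x \<in> A - B}"
      then have "x \<in> C \<union> T" using CT(3) by auto
      moreover have "x \<notin> C" using x K(2) unfolding B_def by blast
      ultimately show "x \<in> T" by blast
    qed
    then show "{x \<in> -{0}. x /\<^sub>R norm x \<in> A - B} \<in> null_sets lebesgue"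
      using CT(2) completion.complete2 by blast
  qed
qed

text \<open>
  Applying the inner approximation to \<open>A\<close> and to its complement in the sphere squeezes \<open>A\<close> between two
  Borel sets. The cone over their difference is null, hence so is the difference.
\<close>

lemma sets_surface_measureI:
  fixes A :: "'a::euclidean_space set"
  assumes A: "A \<subseteq> sphere 0 1" and cone: "{x \<in> -{0}. x /\<^sub>R norm x \<in> A} \<in> sets lebesgue"
  shows "A \<in> sets surface_measure"
proof -
  let ?C = "\<lambda>A. {x \<in> -{0::'a}. x /\<^sub>R norm x \<in> A}"
  have S: "sphere 0 1 \<in> sets (sphere_borel :: 'a measure)"
    by (simp add: sets_sphere_borel_iff del: sets_sphere_borel)
  obtain B where B: "B \<in> sets sphere_borel" "B \<subseteq> A" "?C (A - B) \<in> null_sets lebesgue"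
    using cone_inner_borel[OF A cone] by blast
  have "?C (sphere 0 1 - A) = -{0} - ?C A" by auto
  also have "\<dots> \<in> sets lebesgue" using cone by auto
  finally obtain B' where B': "B' \<in> sets sphere_borel" "B' \<subseteq> sphere 0 1 - A"
      "?C (sphere 0 1 - A - B') \<in> null_sets lebesgue"
    using cone_inner_borel[of "sphere 0 1 - A"] by blast
  define N where "N = sphere 0 1 - B' - B"
  have N: "N \<in> sets sphere_borel" unfolding N_def using S B(1) B'(1) by blast
  have "N \<in> sets borel" using N unfolding sets_sphere_borel_iff by blast
  from direction_vimage_borel[OF this, of UNIV] have CN: "?C N \<in> sets borel"
    by (simp add: Compl_eq_Diff_UNIV)
  have "?C N \<subseteq> ?C (A - B) \<union> ?C (sphere 0 1 - A - B')"
    unfolding N_def by auto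
  then have "?C N \<in> null_sets lebesgue"
    by (rule completion.complete2[OF _ null_sets.Un[OF B(3) B'(3)]])
  then have "?C N \<in> null_sets lborel"
    using CN by (simp add: null_sets_completion_iff)
  then have "N \<in> null_sets sphere_borel"
    using null_cone_iff[OF N] by blast
  moreover have "A = B \<union> (A - B)" "A - B \<subseteq> N"
    using A B(2) B'(2) by (auto simp: N_def)
  ultimately show ?thesis
    unfolding surface_measure_eq_completion using B(1) by (intro sets_completionI)
qed

lemma borel_measurable_surface_measureI:
  fixes w :: "'a::euclidean_space \<Rightarrow> real"
  assumes "(\<lambda>x. w (x /\<^sub>R norm x)) \<in> borel_measurable (lebesgue_on (-{0}))"
  shows "w \<in> borel_measurable surface_measure"
proof (rule borel_measurableI_le)
  fix a
  have "{x \<in> space (lebesgue_on (-{0::'a})). w (x /\<^sub>R norm x) \<le> a} \<in> sets (lebesgue_on (-{0}))"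
    using assms by measurable
  then have "{x \<in> -{0}. x /\<^sub>R norm x \<in> {\<Omega> \<in> sphere 0 1. w \<Omega> \<le> a}} \<in> sets lebesgue"
    by (subst (asm) sets_restrict_space_iff)
       (auto elim!: back_subst[where P = "\<lambda>A. A \<in> sets lebesgue"])
  then show "{\<Omega> \<in> space surface_measure. w \<Omega> \<le> a} \<in> sets surface_measure"
    by (intro sets_surface_measureI) auto
qed

section \<open>The formal expansion of the integrand and its truncation error\<close>

abbreviation comp_index :: "nat \<Rightarrow> nat \<Rightarrow> nat list set" where
  "comp_index m r \<equiv> {ns. length ns = r \<and> (\<forall>n\<in>set ns. 1 \<le> n) \<and> sum_list ns = m}"

lemma comp_sum_0: "comp_sum F m 0 \<Omega> = (if m = 0 then 1 else 0)"
proof -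
  have "comp_index m 0 = (if m = 0 then {[]} else {})" by auto
  then show ?thesis by (simp add: comp_sum_def)
qed

text \<open>
  Split off the first entry of the list \<open>[n\<^sub>1, \<dots>, n\<^sub>r\<^sub>+\<^sub>1]\<close>.
\<close>

lemma comp_sum_Suc:
  "comp_sum F m (Suc r) \<Omega> = (\<Sum>n=1..m. F n \<Omega> * comp_sum F (m - n) r \<Omega>)"
proof -
  have "(\<Sum>n=1..m. F n \<Omega> * comp_sum F (m - n) r \<Omega>) =
      (\<Sum>n=1..m. \<Sum>ns\<in>comp_index (m - n) r. F n \<Omega> * (\<Prod>k\<leftarrow>ns. F k \<Omega>))"
    by (simp add: comp_sum_def sum_distrib_left)
  also have "\<dots> = (\<Sum>(n, ns)\<in>Sigma {1..m} (\<lambda>n. comp_index (m - n) r). F n \<Omega> * (\<Prod>k\<leftarrow>ns. F k \<Omega>))"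
    by (rule sum.Sigma) (use finite_comp_sum_index in auto)
  also have "\<dots> = (\<Sum>ns\<in>comp_index m (Suc r). \<Prod>k\<leftarrow>ns. F k \<Omega>)"
    by (rule sum.reindex_bij_witness[where j = "\<lambda>(n, ns). n # ns" and i = "\<lambda>ns. (hd ns, tl ns)"])
       (auto simp: length_Suc_conv)
  finally show ?thesis by (simp add: comp_sum_def)
qed

lemma comp_sum_eq_0: "m < r \<Longrightarrow> comp_sum F m r \<Omega> = 0"
proof (induction r arbitrary: m)
  case (Suc r)
  then show ?case by (auto simp: comp_sum_Suc intro!: sum.neutral)
qed simp

text \<open>
  The coefficients of the Cauchy product of two power series.
\<close>

definition convolution :: "(nat \<Rightarrow> real) \<Rightarrow> (nat \<Rightarrow> real) \<Rightarrow> nat \<Rightarrow> real" where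
  "convolution a b j = (\<Sum>m\<le>j. a m * b (j - m))"

lemma sum_convolution:
  "(\<Sum>j\<le>N. x ^ j * convolution a b j) = (\<Sum>(i, j)\<in>{(i, j). i + j \<le> N}. (a i * x ^ i) * (b j * x ^ j))"
proof -
  have "(\<Sum>(i, j)\<in>{(i, j). i + j \<le> N}. (a i * x ^ i) * (b j * x ^ j)) =
      (\<Sum>k\<le>N. \<Sum>i\<le>k. (a i * x ^ i) * (b (k - i) * x ^ (k - i)))"
    by (rule sum.triangle_reindex_eq)
  also have "\<dots> = (\<Sum>k\<le>N. x ^ k * convolution a b k)"
    unfolding convolution_def sum_distrib_left
    by (intro sum.cong refl) (auto simp: power_add[symmetric] mult_ac)
  finally show ?thesis ..
qed

lemma sum_abs_convolution_le:
  "(\<Sum>j\<le>N. \<bar>convolution a b j\<bar>) \<le> (\<Sum>i\<le>N. \<bar>a i\<bar>) * (\<Sum>j\<le>N. \<bar>b j\<bar>)"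
proof -
  have "(\<Sum>j\<le>N. \<bar>convolution a b j\<bar>) \<le> (\<Sum>j\<le>N. 1 ^ j * convolution (\<lambda>i. \<bar>a i\<bar>) (\<lambda>i. \<bar>b i\<bar>) j)"
    unfolding convolution_def
    by (intro sum_mono) (auto simp: abs_mult intro!: order.trans[OF sum_abs])
  also have "\<dots> = (\<Sum>(i, j)\<in>{(i, j). i + j \<le> N}. \<bar>a i\<bar> * \<bar>b j\<bar>)"
    unfolding sum_convolution by simp
  also have "\<dots> \<le> (\<Sum>(i, j)\<in>{..N} \<times> {..N}. \<bar>a i\<bar> * \<bar>b j\<bar>)"
    by (intro sum_mono2) auto
  also have "\<dots> = (\<Sum>i\<le>N. \<bar>a i\<bar>) * (\<Sum>j\<le>N. \<bar>b j\<bar>)"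
    by (simp add: sum_product sum.cartesian_product)
  finally show ?thesis .
qed

text \<open>
  The discarded terms of the product are exactly those of total degree at least \<open>N + 1\<close>.
\<close>

lemma truncated_product:
  fixes x :: real
  assumes x: "0 \<le> x" "x \<le> 1"
  shows "\<bar>(\<Sum>i\<le>N. a i * x ^ i) * (\<Sum>j\<le>N. b j * x ^ j) - (\<Sum>j\<le>N. x ^ j * convolution a b j)\<bar>
           \<le> x ^ Suc N * ((\<Sum>i\<le>N. \<bar>a i\<bar>) * (\<Sum>j\<le>N. \<bar>b j\<bar>))"
proof -
  let ?S = "{..N} \<times> {..N}" and ?T = "{(i, j). i + j \<le> N}"
  have sub: "?T \<subseteq> ?S" by auto
  have "(\<Sum>i\<le>N. a i * x ^ i) * (\<Sum>j\<le>N. b j * x ^ j) - (\<Sum>j\<le>N. x ^ j * convolution a b j) =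
      (\<Sum>(i, j)\<in>?S - ?T. (a i * x ^ i) * (b j * x ^ j))"
    unfolding sum_convolution sum_product sum.cartesian_product
    by (rule sum_diff[OF _ sub, symmetric]) simp
  also have "\<bar>\<dots>\<bar> \<le> (\<Sum>(i, j)\<in>?S - ?T. x ^ Suc N * (\<bar>a i\<bar> * \<bar>b j\<bar>))"
  proof (rule order.trans[OF sum_abs], rule sum_mono)
    fix p assume "p \<in> ?S - ?T"
    then obtain i j where p: "p = (i, j)" and "\<not> i + j \<le> N" by (cases p) auto
    then have "x ^ (i + j) \<le> x ^ Suc N" using x by (intro power_decreasing) auto
    then have "x ^ (i + j) * (\<bar>a i\<bar> * \<bar>b j\<bar>) \<le> x ^ Suc N * (\<bar>a i\<bar> * \<bar>b j\<bar>)"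
      by (intro mult_right_mono) auto
    then show "\<bar>case p of (i, j) \<Rightarrow> (a i * x ^ i) * (b j * x ^ j)\<bar> \<le>
        (case p of (i, j) \<Rightarrow> x ^ Suc N * (\<bar>a i\<bar> * \<bar>b j\<bar>))"
      using x unfolding p by (simp add: abs_mult power_add mult_ac)
  qed
  also have "\<dots> \<le> (\<Sum>(i, j)\<in>?S. x ^ Suc N * (\<bar>a i\<bar> * \<bar>b j\<bar>))"
    using x by (intro sum_mono2) auto
  also have "\<dots> = x ^ Suc N * ((\<Sum>i\<le>N. \<bar>a i\<bar>) * (\<Sum>j\<le>N. \<bar>b j\<bar>))"
    unfolding sum_product sum.cartesian_product
    by (subst sum_distrib_left) (intro sum.cong, auto)
  finally show ?thesis .
qed

lemma abs_poly_sum_le: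
  fixes x :: real
  assumes x: "0 \<le> x" "x \<le> 1"
  shows "\<bar>\<Sum>i\<le>N. a i * x ^ i\<bar> \<le> (\<Sum>i\<le>N. \<bar>a i\<bar>)"
proof (rule order.trans[OF sum_abs], rule sum_mono)
  fix i
  have "\<bar>a i\<bar> * x ^ i \<le> \<bar>a i\<bar> * 1"
    using x by (intro mult_left_mono) (auto intro: power_le_one)
  then show "\<bar>a i * x ^ i\<bar> \<le> \<bar>a i\<bar>" using x by (simp add: abs_mult)
qed

text \<open>
  With polynomials \<open>a\<close> and \<open>b\<close> approximating \<open>A\<close> and \<open>B\<close>, the error is \<open>(A - a) B + a (B - b)\<close> plus the
  truncation error of \<open>a b\<close>. It is applied both in the induction over the powers of the exponent and to
  the product of the exponential with the amplitude \<open>\<gamma>\<close>.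
\<close>

lemma approx_product:
  fixes x :: real
  assumes x: "0 \<le> x" "x \<le> 1"
    and A: "\<bar>A - (\<Sum>i\<le>N. a i * x ^ i)\<bar> \<le> \<alpha>" and B: "\<bar>B - (\<Sum>j\<le>N. b j * x ^ j)\<bar> \<le> \<beta>"
  shows "\<bar>A * B - (\<Sum>j\<le>N. x ^ j * convolution a b j)\<bar> \<le>
           \<alpha> * \<bar>B\<bar> + (\<Sum>i\<le>N. \<bar>a i\<bar>) * \<beta> + x ^ Suc N * ((\<Sum>i\<le>N. \<bar>a i\<bar>) * (\<Sum>j\<le>N. \<bar>b j\<bar>))"
proof -
  let ?a = "\<Sum>i\<le>N. a i * x ^ i" and ?b = "\<Sum>j\<le>N. b j * x ^ j"
  have "A * B - (\<Sum>j\<le>N. x ^ j * convolution a b j) =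
      (A - ?a) * B + ?a * (B - ?b) + (?a * ?b - (\<Sum>j\<le>N. x ^ j * convolution a b j))"
    by (simp add: algebra_simps)
  moreover have "\<bar>(A - ?a) * B\<bar> \<le> \<alpha> * \<bar>B\<bar>"
    unfolding abs_mult by (intro mult_right_mono A) auto
  moreover have "\<bar>?a * (B - ?b)\<bar> \<le> (\<Sum>i\<le>N. \<bar>a i\<bar>) * \<beta>"
    unfolding abs_mult by (intro mult_mono abs_poly_sum_le x B sum_nonneg) auto
  moreover note truncated_product[OF x, where N = N and a = a and b = b]
  ultimately show ?thesis by linarith
qed

text \<open>
  The coefficient of \<open>\<rho>\<^sup>m\<close> in the formal expansion of \<open>exp (- t * (\<Sum>n\<ge>1. F n \<Omega> * \<rho> ^ n))\<close>. Terms with \<open>r > m\<close>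
  vanish because \<open>m\<close> is not a sum of more than \<open>m\<close> positive integers.
\<close>

definition exp_coeff :: "(nat \<Rightarrow> 'a \<Rightarrow> real) \<Rightarrow> 'a \<Rightarrow> real \<Rightarrow> nat \<Rightarrow> real" where
  "exp_coeff F \<Omega> t m = (\<Sum>r\<le>m. (- t) ^ r / fact r * comp_sum F m r \<Omega>)"

text \<open>
  The expansion of \<open>exp (- t * \<phi>) * \<gamma>\<close>, truncated after \<open>\<rho>\<^sup>N\<close>, for \<open>\<phi> = c + (\<Sum>n\<ge>1. F n \<Omega> * \<rho> ^ n)\<close> and
  \<open>\<gamma> = (\<Sum>j. G j \<Omega> * \<rho> ^ j)\<close>. The variables \<open>\<rho>\<close> and \<open>t\<close> are kept independent; later \<open>t = k * \<rho> powr \<nu>\<close>.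
\<close>

definition laplace_model ::
  "real \<Rightarrow> (nat \<Rightarrow> 'a \<Rightarrow> real) \<Rightarrow> (nat \<Rightarrow> 'a \<Rightarrow> real) \<Rightarrow> nat \<Rightarrow> 'a \<Rightarrow> real \<Rightarrow> real \<Rightarrow> real" where
  "laplace_model c F G N \<Omega> \<rho> t =
     exp (- c * t) * (\<Sum>j\<le>N. \<rho> ^ j * convolution (exp_coeff F \<Omega> t) (\<lambda>i. G i \<Omega>) j)"

text \<open>
  Read as a Cauchy product, the recursion says that \<open>comp_sum F m r \<Omega>\<close> is the coefficient of \<open>\<rho>\<^sup>m\<close> in the
  \<open>r\<close>-th power of a power series without constant term.
\<close>

lemma comp_sum_Suc_convolution:
  "comp_sum F m (Suc r) \<Omega> =
     convolution (\<lambda>n. if n = 0 then 0 else F n \<Omega>) (\<lambda>m. comp_sum F m r \<Omega>) m"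
proof -
  have "{..m} = insert 0 {1..m}" by auto
  then show ?thesis unfolding convolution_def comp_sum_Suc by simp
qed

lemma sum_positive_index:
  fixes a :: "nat \<Rightarrow> real"
  shows "(\<Sum>n\<le>N. (if n = 0 then 0 else a n) * x ^ n) = (\<Sum>n=1..N. a n * x ^ n)"
proof -
  have "{..N} = insert 0 {1..N}" by auto
  then show ?thesis by simp
qed

context
  fixes F :: "nat \<Rightarrow> 'a \<Rightarrow> real" and \<Omega> :: 'a and N :: nat and L :: real
  assumes L: "(\<Sum>n=1..N. \<bar>F n \<Omega>\<bar>) \<le> L"
begin

private lemma L': "(\<Sum>n\<le>N. \<bar>if n = 0 then 0 else F n \<Omega>\<bar>) \<le> L"
proof -
  have "{..N} = insert 0 {1..N}" by auto
  then show ?thesis using L by simp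
qed

private lemma L0: "0 \<le> L"
  using L by (meson order.trans sum_nonneg abs_ge_zero)

lemma sum_abs_comp_sum_le: "(\<Sum>m\<le>N. \<bar>comp_sum F m r \<Omega>\<bar>) \<le> L ^ r"
proof (induction r)
  case 0
  have "(\<Sum>m\<le>N. \<bar>comp_sum F m 0 \<Omega>\<bar>) = (\<Sum>m\<in>{..N}. if m = 0 then 1 else 0)"
    unfolding comp_sum_0 by (intro sum.cong) auto
  then show ?case by simp
next
  case (Suc r)
  have "(\<Sum>m\<le>N. \<bar>comp_sum F m (Suc r) \<Omega>\<bar>) \<le>
      (\<Sum>n\<le>N. \<bar>if n = 0 then 0 else F n \<Omega>\<bar>) * (\<Sum>m\<le>N. \<bar>comp_sum F m r \<Omega>\<bar>)"
    unfolding comp_sum_Suc_convolution by (rule sum_abs_convolution_le)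
  also have "\<dots> \<le> L * L ^ r"
    by (intro mult_mono L' Suc L0 sum_nonneg) auto
  finally show ?case by simp
qed

lemma power_expansion:
  assumes \<rho>: "0 \<le> \<rho>" "\<rho> \<le> 1"
  shows "\<bar>(\<Sum>n=1..N. F n \<Omega> * \<rho> ^ n) ^ r - (\<Sum>m\<le>N. comp_sum F m r \<Omega> * \<rho> ^ m)\<bar> \<le> real r * L ^ r * \<rho> ^ Suc N"
proof (induction r)
  case 0
  have "(\<Sum>m\<le>N. comp_sum F m 0 \<Omega> * \<rho> ^ m) = (\<Sum>m\<in>{..N}. if m = 0 then 1 else 0)"
    unfolding comp_sum_0 by (intro sum.cong) auto
  then show ?case by simp
next
  case (Suc r)
  let ?a = "\<lambda>n. if n = 0 then 0 else F n \<Omega>" and ?P = "\<Sum>n=1..N. F n \<Omega> * \<rho> ^ n"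
  have "\<bar>?P * ?P ^ r - (\<Sum>m\<le>N. \<rho> ^ m * convolution ?a (\<lambda>m. comp_sum F m r \<Omega>) m)\<bar> \<le>
      0 * \<bar>?P ^ r\<bar> + (\<Sum>n\<le>N. \<bar>?a n\<bar>) * (real r * L ^ r * \<rho> ^ Suc N) +
      \<rho> ^ Suc N * ((\<Sum>n\<le>N. \<bar>?a n\<bar>) * (\<Sum>m\<le>N. \<bar>comp_sum F m r \<Omega>\<bar>))"
    by (rule approx_product[OF \<rho> _ Suc]) (subst sum_positive_index, simp)
  also have "\<dots> \<le> 0 * \<bar>?P ^ r\<bar> + L * (real r * L ^ r * \<rho> ^ Suc N) + \<rho> ^ Suc N * (L * L ^ r)"
    using \<rho> L0 by (intro add_mono mult_mono L' sum_abs_comp_sum_le mult_nonneg_nonneg sum_nonneg) auto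
  also have "\<dots> = real (Suc r) * L ^ Suc r * \<rho> ^ Suc N" by (simp add: algebra_simps)
  finally show ?case
    by (simp only: comp_sum_Suc_convolution power_Suc mult.commute[of "\<rho> ^ _" "convolution _ _ _"])
qed

lemma sum_abs_exp_coeff_le:
  assumes t: "0 \<le> t"
  shows "(\<Sum>m\<le>N. \<bar>exp_coeff F \<Omega> t m\<bar>) \<le> (1 + t) ^ Suc N * (\<Sum>r\<le>N. L ^ r)"
proof -
  have "(\<Sum>m\<le>N. \<bar>exp_coeff F \<Omega> t m\<bar>) \<le> (\<Sum>m\<le>N. \<Sum>r\<le>N. (1 + t) ^ Suc N * \<bar>comp_sum F m r \<Omega>\<bar>)"
  proof (rule sum_mono)
    fix m assume m: "m \<in> {..N}"
    have "\<bar>exp_coeff F \<Omega> t m\<bar> \<le> (\<Sum>r\<le>m. \<bar>(- t) ^ r / fact r * comp_sum F m r \<Omega>\<bar>)"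
      unfolding exp_coeff_def by (rule sum_abs)
    also have "\<dots> \<le> (\<Sum>r\<le>m. (1 + t) ^ Suc N * \<bar>comp_sum F m r \<Omega>\<bar>)"
    proof (rule sum_mono)
      fix r assume r: "r \<in> {..m}"
      have "\<bar>(- t) ^ r / fact r\<bar> \<le> t ^ r"
        using t by (simp add: abs_mult power_abs divide_le_eq mult_le_cancel_left1 fact_ge_1)
      also have "\<dots> \<le> (1 + t) ^ r" using t by (intro power_mono) auto
      also have "\<dots> \<le> (1 + t) ^ Suc N" using t r m by (intro power_increasing) auto
      finally show "\<bar>(- t) ^ r / fact r * comp_sum F m r \<Omega>\<bar> \<le> (1 + t) ^ Suc N * \<bar>comp_sum F m r \<Omega>\<bar>"
        unfolding abs_mult[of _ "comp_sum F m r \<Omega>"] by (intro mult_right_mono) auto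
    qed
    also have "\<dots> \<le> (\<Sum>r\<le>N. (1 + t) ^ Suc N * \<bar>comp_sum F m r \<Omega>\<bar>)"
      using m t by (intro sum_mono2) auto
    finally show "\<bar>exp_coeff F \<Omega> t m\<bar> \<le> (\<Sum>r\<le>N. (1 + t) ^ Suc N * \<bar>comp_sum F m r \<Omega>\<bar>)" .
  qed
  also have "\<dots> = (1 + t) ^ Suc N * (\<Sum>r\<le>N. \<Sum>m\<le>N. \<bar>comp_sum F m r \<Omega>\<bar>)"
    by (subst sum.swap) (simp add: sum_distrib_left)
  also have "\<dots> \<le> (1 + t) ^ Suc N * (\<Sum>r\<le>N. L ^ r)"
    using t by (intro mult_left_mono sum_mono sum_abs_comp_sum_le) auto
  finally show ?thesis .
qed

text \<open>
  Three errors are added: replacing \<open>\<psi>\<close> by its polynomial part \<open>P\<close>, cutting the exponential series of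
  \<open>- t P\<close> after the power \<open>N\<close>, and cutting each power \<open>P\<^sup>r\<close> after \<open>\<rho>\<^sup>N\<close>. The smallness conditions keep
  \<open>|t \<psi>|\<close> below \<open>c t / 2\<close>, so that the growth \<open>exp (c t / 2)\<close> on the right is absorbed by \<open>exp (- c t)\<close> later.
\<close>

lemma exp_expansion:
  assumes \<rho>: "0 \<le> \<rho>" "\<rho> \<le> 1" "L * \<rho> \<le> c / 4" and t: "0 \<le> t"
    and \<psi>: "\<bar>\<psi> - (\<Sum>n=1..N. F n \<Omega> * \<rho> ^ n)\<bar> \<le> \<eta> * \<rho> ^ N" and \<eta>: "0 \<le> \<eta>" "\<eta> \<le> c / 4"
  shows "\<bar>exp (- t * \<psi>) - (\<Sum>m\<le>N. exp_coeff F \<Omega> t m * \<rho> ^ m)\<bar> \<le>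
     (1 + L ^ Suc N + real N * (\<Sum>r\<le>N. L ^ r)) * ((\<eta> + \<rho>) * \<rho> ^ N * ((1 + t) ^ Suc N * exp (c * t / 2)))"
proof -
  let ?P = "\<Sum>n=1..N. F n \<Omega> * \<rho> ^ n" and ?q = "\<lambda>r. \<Sum>m\<le>N. comp_sum F m r \<Omega> * \<rho> ^ m"
  define E where "E = (1 + t) ^ Suc N * exp (c * t / 2)"
  have c: "0 \<le> c" using \<eta> by simp
  have pow_le: "t ^ r \<le> (1 + t) ^ Suc N" if "r \<le> Suc N" for r
  proof -
    have "t ^ r \<le> (1 + t) ^ r" using t by (intro power_mono) auto
    also have "\<dots> \<le> (1 + t) ^ Suc N" using t that by (intro power_increasing) auto
    finally show ?thesis .
  qed
  have exp_ge_1: "1 \<le> exp (c * t / 2)" using c t by simp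
  have E_ge: "t ^ r \<le> E" if "r \<le> Suc N" for r
    using mult_mono[OF pow_le[OF that] exp_ge_1] t unfolding E_def by simp
  have E0: "0 \<le> E" using t unfolding E_def by simp
  have P: "\<bar>?P\<bar> \<le> L * \<rho>"
  proof -
    have "\<bar>?P\<bar> \<le> (\<Sum>n=1..N. \<bar>F n \<Omega>\<bar> * \<rho>)"
    proof (rule order.trans[OF sum_abs], rule sum_mono)
      fix n assume "n \<in> {1..N}"
      then have "\<rho> ^ n \<le> \<rho> ^ 1" using \<rho> by (intro power_decreasing) auto
      then have "\<bar>F n \<Omega>\<bar> * \<rho> ^ n \<le> \<bar>F n \<Omega>\<bar> * \<rho>" by (intro mult_left_mono) auto
      then show "\<bar>F n \<Omega> * \<rho> ^ n\<bar> \<le> \<bar>F n \<Omega>\<bar> * \<rho>" using \<rho> by (simp add: abs_mult)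
    qed
    also have "\<dots> \<le> L * \<rho>"
      using L \<rho> by (simp add: sum_distrib_right[symmetric] mult_right_mono)
    finally show ?thesis .
  qed
  have tP: "\<bar>- t * ?P\<bar> \<le> c * t / 4"
    using mult_left_mono[OF order.trans[OF P \<rho>(3)] t] t by (simp add: abs_mult mult.commute)
  have "\<eta> * \<rho> ^ N \<le> c / 4"
    using mult_mono[OF \<eta>(2) power_le_one[of \<rho> N]] \<rho> \<eta> by simp
  then have "\<bar>\<psi>\<bar> \<le> c / 2" using \<psi> P \<rho>(3) by linarith
  then have t\<psi>: "\<bar>- t * \<psi>\<bar> \<le> c * t / 2"
    using mult_left_mono[of "\<bar>\<psi>\<bar>" "c / 2" t] t by (simp add: abs_mult mult.commute)
  \<comment> \<open>First error: the remainder of \<open>\<psi>\<close>, by the mean value theorem.\<close>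
  have T1: "\<bar>exp (- t * \<psi>) - exp (- t * ?P)\<bar> \<le> \<eta> * \<rho> ^ N * E"
  proof -
    have "\<bar>exp (- t * \<psi>) - exp (- t * ?P)\<bar> \<le> exp (c * t / 2) * \<bar>- t * \<psi> - - t * ?P\<bar>"
    proof -
      have "norm (exp (- t * \<psi>) - exp (- t * ?P)) \<le> exp (c * t / 2) * norm (- t * \<psi> - - t * ?P)"
      proof (rule field_differentiable_bound[where S = "{.. c * t / 2}" and f' = exp])
        show "- t * \<psi> \<in> {..c * t / 2}" "- t * ?P \<in> {..c * t / 2}"
          using t\<psi> tP c t by (auto simp: abs_le_iff intro: order.trans)
      qed (auto intro!: derivative_eq_intros)
      then show ?thesis by simp
    qed
    also have "\<bar>- t * \<psi> - - t * ?P\<bar> = t * \<bar>\<psi> - ?P\<bar>"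
    proof -
      have "- t * \<psi> - - t * ?P = t * (?P - \<psi>)" by (simp only: right_diff_distrib)
      then show ?thesis using t by (simp only: abs_mult abs_of_nonneg abs_minus_commute)
    qed
    also have "exp (c * t / 2) * (t * \<bar>\<psi> - ?P\<bar>) \<le> exp (c * t / 2) * ((1 + t) ^ Suc N * (\<eta> * \<rho> ^ N))"
      using pow_le[of 1] t \<psi> by (intro mult_left_mono mult_mono) auto
    finally show ?thesis by (simp add: E_def mult_ac)
  qed
  \<comment> \<open>Second error: Taylor's theorem for the exponential function.\<close>
  have T2: "\<bar>exp (- t * ?P) - (\<Sum>r\<le>N. (- t * ?P) ^ r / fact r)\<bar> \<le> L ^ Suc N * \<rho> ^ Suc N * E"
  proof -
    have "norm (exp (- t * ?P) - (\<Sum>r\<le>N. (- t * ?P) ^ r / fact r)) \<le>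
        exp (norm (- t * ?P)) * norm (- t * ?P) ^ Suc N / fact N"
      by (rule Taylor_exp_field)
    also have "\<dots> \<le> exp (norm (- t * ?P)) * norm (- t * ?P) ^ Suc N"
    proof -
      have "y / fact N \<le> y" if "0 \<le> y" for y :: real
        using that fact_ge_1[of N, where 'a = real] by (simp add: divide_le_eq mult_le_cancel_left1)
      then show ?thesis by (meson exp_ge_zero mult_nonneg_nonneg norm_ge_zero zero_le_power)
    qed
    also have "\<dots> \<le> exp (c * t / 2) * ((L * \<rho>) ^ Suc N * (1 + t) ^ Suc N)"
    proof (intro mult_mono)
      have "c * t / 4 \<le> c * t / 2" using c t by simp
      then show "exp (norm (- t * ?P)) \<le> exp (c * t / 2)" using tP by simp
      have "norm (- t * ?P) ^ Suc N = \<bar>?P\<bar> ^ Suc N * t ^ Suc N"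
        using t by (simp add: abs_mult power_mult_distrib mult_ac)
      also have "\<dots> \<le> (L * \<rho>) ^ Suc N * (1 + t) ^ Suc N"
        using P t pow_le[of "Suc N"] by (intro mult_mono power_mono) auto
      finally show "norm (- t * ?P) ^ Suc N \<le> (L * \<rho>) ^ Suc N * (1 + t) ^ Suc N" .
    qed auto
    finally show ?thesis by (simp add: E_def power_mult_distrib mult_ac)
  qed
  \<comment> \<open>Third error: the powers of \<open>P\<close>; all sums over \<open>r\<close> may be extended to \<open>N\<close>.\<close>
  have T3: "\<bar>(\<Sum>r\<le>N. (- t * ?P) ^ r / fact r) - (\<Sum>m\<le>N. exp_coeff F \<Omega> t m * \<rho> ^ m)\<bar> \<le>
      real N * (\<Sum>r\<le>N. L ^ r) * \<rho> ^ Suc N * E"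
  proof -
    have "exp_coeff F \<Omega> t m = (\<Sum>r\<le>N. (- t) ^ r / fact r * comp_sum F m r \<Omega>)" if "m \<le> N" for m
      unfolding exp_coeff_def using that
      by (intro sum.mono_neutral_left) (auto simp: comp_sum_eq_0)
    then have "(\<Sum>m\<le>N. exp_coeff F \<Omega> t m * \<rho> ^ m) =
        (\<Sum>m\<le>N. \<Sum>r\<le>N. (- t) ^ r / fact r * (comp_sum F m r \<Omega> * \<rho> ^ m))"
      by (intro sum.cong refl) (simp only: atMost_iff sum_distrib_right mult.assoc)
    also have "\<dots> = (\<Sum>r\<le>N. (- t) ^ r / fact r * ?q r)"
      by (subst sum.swap) (simp add: sum_distrib_left)
    finally have "(\<Sum>r\<le>N. (- t * ?P) ^ r / fact r) - (\<Sum>m\<le>N. exp_coeff F \<Omega> t m * \<rho> ^ m) =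
        (\<Sum>r\<le>N. (- t) ^ r / fact r * (?P ^ r - ?q r))"
      by (simp only: power_mult_distrib right_diff_distrib sum_subtractf times_divide_eq_left)
    also have "\<bar>\<dots>\<bar> \<le> (\<Sum>r\<le>N. E * (real N * L ^ r * \<rho> ^ Suc N))"
    proof (rule order.trans[OF sum_abs], rule sum_mono)
      fix r assume r: "r \<in> {..N}"
      have "\<bar>(- t) ^ r / fact r\<bar> \<le> t ^ r"
        using t by (simp add: abs_mult power_abs divide_le_eq mult_le_cancel_left1 fact_ge_1)
      also have "\<dots> \<le> E" using r by (intro E_ge) auto
      finally have "\<bar>(- t) ^ r / fact r\<bar> \<le> E" .
      moreover have "\<bar>?P ^ r - ?q r\<bar> \<le> real N * L ^ r * \<rho> ^ Suc N"
        using power_expansion[OF \<rho>(1,2), of r] r \<rho> L0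
        by (elim order.trans) (intro mult_right_mono, auto)
      ultimately show "\<bar>(- t) ^ r / fact r * (?P ^ r - ?q r)\<bar> \<le> E * (real N * L ^ r * \<rho> ^ Suc N)"
        unfolding abs_mult[of _ "?P ^ r - ?q r"] by (intro mult_mono E0) auto
    qed
    also have "\<dots> = real N * (\<Sum>r\<le>N. L ^ r) * \<rho> ^ Suc N * E"
      by (simp add: sum_distrib_left sum_distrib_right mult_ac)
    finally show ?thesis .
  qed
  have le: "\<eta> * \<rho> ^ N \<le> (\<eta> + \<rho>) * \<rho> ^ N" "\<rho> ^ Suc N \<le> (\<eta> + \<rho>) * \<rho> ^ N"
    using \<rho> \<eta> by (auto intro!: mult_right_mono)
  have S0: "0 \<le> (\<Sum>r\<le>N. L ^ r)" using L0 by (intro sum_nonneg) auto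
  have "\<eta> * \<rho> ^ N * E \<le> 1 * ((\<eta> + \<rho>) * \<rho> ^ N * E)"
    using mult_right_mono[OF le(1) E0] by simp
  moreover have "L ^ Suc N * \<rho> ^ Suc N * E \<le> L ^ Suc N * ((\<eta> + \<rho>) * \<rho> ^ N * E)"
    using mult_left_mono[OF mult_right_mono[OF le(2) E0], of "L ^ Suc N"] L0 by (simp only: mult.assoc zero_le_power)
  moreover have "real N * (\<Sum>r\<le>N. L ^ r) * \<rho> ^ Suc N * E \<le> real N * (\<Sum>r\<le>N. L ^ r) * ((\<eta> + \<rho>) * \<rho> ^ N * E)"
    using mult_left_mono[OF mult_right_mono[OF le(2) E0], of "real N * (\<Sum>r\<le>N. L ^ r)"] S0
    by (simp only: mult.assoc) simp
  ultimately show ?thesis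
    using T1 T2 T3 unfolding E_def[symmetric] distrib_right by linarith
qed

end

text \<open>
  Polynomial growth in \<open>t\<close> is absorbed by an arbitrarily small exponential rate; the constant comes
  from \<open>(1 + \<epsilon> t / n)\<^sup>n \<le> exp (\<epsilon> t)\<close>.
\<close>

lemma one_plus_power_le_exp:
  fixes \<epsilon> :: real
  assumes "0 < \<epsilon>"
  obtains C where "1 \<le> C" "\<And>t. 0 \<le> t \<Longrightarrow> (1 + t) ^ n \<le> C * exp (\<epsilon> * t)"
proof
  define B where "B = max 1 (real n / \<epsilon>)"
  show "1 \<le> B ^ n" by (simp add: B_def)
  fix t :: real
  assume t: "0 \<le> t"
  show "(1 + t) ^ n \<le> B ^ n * exp (\<epsilon> * t)"
  proof (cases "n = 0")
    case False
    have "t = (real n / \<epsilon>) * (\<epsilon> * t / real n)" using assms False by simp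
    also have "\<dots> \<le> B * (\<epsilon> * t / real n)"
      using assms t by (intro mult_right_mono) (auto simp: B_def)
    finally have "1 + t \<le> B * (1 + \<epsilon> * t / real n)"
      using \<open>1 \<le> B ^ n\<close> by (simp only: distrib_left mult_1_right) (simp add: B_def)
    then have "(1 + t) ^ n \<le> (B * (1 + \<epsilon> * t / real n)) ^ n"
      using t by (intro power_mono) auto
    also have "\<dots> \<le> B ^ n * exp (\<epsilon> * t)"
    proof -
      have "- real n \<le> \<epsilon> * t" using assms t mult_nonneg_nonneg[of \<epsilon> t] by linarith
      then show ?thesis
        unfolding power_mult_distrib using False
        by (intro mult_left_mono exp_ge_one_plus_x_over_n_power_n) (auto simp: B_def)
    qed
    finally show ?thesis .
  qed (use assms t in simp)
qed

text \<open>
  The pointwise error near the origin. The constant depends on the direction only through the bound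
  \<open>L\<close> for the coefficients of \<open>f\<close>, and the coefficients of \<open>g\<close>, which may be unbounded, enter only through
  the integrable weight \<open>1 + (\<Sum>j\<le>N. \<bar>G j \<Omega>\<bar>)\<close>. Of the decay \<open>exp (- c t)\<close> a half is spent on the error of the
  exponent and a quarter on powers of \<open>t\<close>.
\<close>

lemma laplace_model_local:
  fixes c L :: real and F G :: "nat \<Rightarrow> 'a \<Rightarrow> real"
  assumes c: "0 < c" and L: "0 \<le> L"
  obtains C where "0 \<le> C"
    "\<And>\<Omega> \<rho> t \<eta> \<phi> \<gamma>.
       (\<Sum>n=1..N. \<bar>F n \<Omega>\<bar>) \<le> L \<Longrightarrow> 0 \<le> \<rho> \<Longrightarrow> \<rho> \<le> 1 \<Longrightarrow> L * \<rho> \<le> c / 4 \<Longrightarrow> 0 \<le> t \<Longrightarrow>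
       0 \<le> \<eta> \<Longrightarrow> \<eta> \<le> c / 4 \<Longrightarrow> \<eta> \<le> 1 \<Longrightarrow>
       \<bar>\<phi> - (c + (\<Sum>n=1..N. F n \<Omega> * \<rho> ^ n))\<bar> \<le> \<eta> * \<rho> ^ N \<Longrightarrow>
       \<bar>\<gamma> - (\<Sum>j\<le>N. G j \<Omega> * \<rho> ^ j)\<bar> \<le> \<eta> * \<rho> ^ N \<Longrightarrow>
       \<bar>exp (- t * \<phi>) * \<gamma> - laplace_model c F G N \<Omega> \<rho> t\<bar> \<le>
         C * (\<eta> + \<rho>) * \<rho> ^ N * exp (- c * t / 4) * (1 + (\<Sum>j\<le>N. \<bar>G j \<Omega>\<bar>))"
proof -
  obtain C0 where C0: "1 \<le> C0" "\<And>t. 0 \<le> t \<Longrightarrow> (1 + t) ^ Suc N \<le> C0 * exp (c / 4 * t)"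
    using one_plus_power_le_exp[of "c / 4" "Suc N"] c by auto
  define C1 where "C1 = 1 + L ^ Suc N + real N * (\<Sum>r\<le>N. L ^ r)"
  define S where "S = (\<Sum>r\<le>N. L ^ r)"
  have S: "0 \<le> S" unfolding S_def using L by (intro sum_nonneg) auto
  have C1: "0 \<le> C1" unfolding C1_def S_def[symmetric] using L S by (intro add_nonneg_nonneg) auto
  show ?thesis
  proof (rule that)
    show "0 \<le> (C1 + 2 * S) * C0" using C1 S C0 by simp
    fix \<Omega> :: 'a and \<rho> t \<eta> \<phi> \<gamma> :: real
    assume FL: "(\<Sum>n=1..N. \<bar>F n \<Omega>\<bar>) \<le> L" and \<rho>: "0 \<le> \<rho>" "\<rho> \<le> 1" "L * \<rho> \<le> c / 4"
      and t: "0 \<le> t" and \<eta>: "0 \<le> \<eta>" "\<eta> \<le> c / 4" "\<eta> \<le> 1"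
      and \<phi>: "\<bar>\<phi> - (c + (\<Sum>n=1..N. F n \<Omega> * \<rho> ^ n))\<bar> \<le> \<eta> * \<rho> ^ N"
      and \<gamma>: "\<bar>\<gamma> - (\<Sum>j\<le>N. G j \<Omega> * \<rho> ^ j)\<bar> \<le> \<eta> * \<rho> ^ N"
    let ?e = "exp_coeff F \<Omega> t" and ?G = "\<Sum>j\<le>N. \<bar>G j \<Omega>\<bar>"
    define T where "T = (1 + t) ^ Suc N"
    define W where "W = 1 + ?G"
    define z where "z = (\<eta> + \<rho>) * \<rho> ^ N"
    have G0: "0 \<le> ?G" by (intro sum_nonneg) auto
    have T0: "0 \<le> T" "1 \<le> exp (c * t / 2)" using t c by (auto simp: T_def)
    have z0: "0 \<le> z" "\<eta> * \<rho> ^ N \<le> z" "\<rho> ^ Suc N \<le> z"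
      using \<rho> \<eta> by (auto simp: z_def intro!: mult_right_mono)
    have A: "\<bar>exp (- t * (\<phi> - c)) - (\<Sum>m\<le>N. ?e m * \<rho> ^ m)\<bar> \<le> C1 * (z * (T * exp (c * t / 2)))"
      unfolding C1_def z_def T_def
      by (rule exp_expansion[where F = F and \<Omega> = \<Omega>, OF FL \<rho> t _ \<eta>(1,2)]) (use \<phi> in \<open>simp add: algebra_simps\<close>)
    have e: "(\<Sum>m\<le>N. \<bar>?e m\<bar>) \<le> T * S"
      unfolding T_def S_def by (rule sum_abs_exp_coeff_le[where F = F and \<Omega> = \<Omega>, OF FL t])
    have "\<eta> * \<rho> ^ N \<le> 1" using \<rho> \<eta> by (intro mult_le_one power_le_one) auto
    then have B: "\<bar>\<gamma>\<bar> \<le> W"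
      using abs_poly_sum_le[OF \<rho>(1,2), of "\<lambda>j. G j \<Omega>" N] \<gamma> unfolding W_def by linarith
    have W1: "1 \<le> W" "?G \<le> W" using G0 by (auto simp: W_def)
    have "\<bar>exp (- t * (\<phi> - c)) * \<gamma> - (\<Sum>j\<le>N. \<rho> ^ j * convolution ?e (\<lambda>i. G i \<Omega>) j)\<bar> \<le>
        C1 * (z * (T * exp (c * t / 2))) * \<bar>\<gamma>\<bar> + (\<Sum>m\<le>N. \<bar>?e m\<bar>) * (\<eta> * \<rho> ^ N) +
        \<rho> ^ Suc N * ((\<Sum>m\<le>N. \<bar>?e m\<bar>) * ?G)"
      by (rule approx_product[OF \<rho>(1,2) A \<gamma>])
    also have "\<dots> \<le> C1 * (z * (T * exp (c * t / 2))) * W + T * S * z + z * (T * S * W)"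
      using C1 z0 T0 S W1 B e \<eta> \<rho> G0
      by (intro add_mono mult_mono mult_nonneg_nonneg sum_nonneg) auto
    also have "\<dots> \<le> C1 * (z * (T * exp (c * t / 2))) * W + T * exp (c * t / 2) * S * z * W +
        T * exp (c * t / 2) * S * z * W"
    proof -
      have "T * S * z * 1 \<le> T * S * z * (exp (c * t / 2) * W)"
        using mult_mono[OF T0(2) W1(1)] T0 S z0 by (intro mult_left_mono) auto
      moreover have "T * S * z * W * 1 \<le> T * S * z * W * exp (c * t / 2)"
        using T0 S z0 W1 by (intro mult_left_mono) auto
      ultimately show ?thesis by (simp add: mult_ac)
    qed
    also have "\<dots> = (C1 + 2 * S) * (z * (T * exp (c * t / 2)) * W)"
      by (simp add: algebra_simps)
    finally have *: "\<bar>exp (- t * (\<phi> - c)) * \<gamma> - (\<Sum>j\<le>N. \<rho> ^ j * convolution ?e (\<lambda>i. G i \<Omega>) j)\<bar> \<le>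
        (C1 + 2 * S) * (z * (T * exp (c * t / 2)) * W)" .
    have "exp (- t * \<phi>) * \<gamma> - laplace_model c F G N \<Omega> \<rho> t =
        exp (- c * t) * (exp (- t * (\<phi> - c)) * \<gamma> - (\<Sum>j\<le>N. \<rho> ^ j * convolution ?e (\<lambda>i. G i \<Omega>) j))"
      unfolding laplace_model_def right_diff_distrib mult.assoc[symmetric] exp_add[symmetric]
      by (simp add: algebra_simps)
    then have "\<bar>exp (- t * \<phi>) * \<gamma> - laplace_model c F G N \<Omega> \<rho> t\<bar> \<le>
        exp (- c * t) * ((C1 + 2 * S) * (z * (T * exp (c * t / 2)) * W))"
      using mult_left_mono[OF *, of "exp (- c * t)"] by (simp add: abs_mult)
    also have "\<dots> \<le> exp (- c * t) * ((C1 + 2 * S) * (z * (C0 * exp (c / 4 * t) * exp (c * t / 2)) * W))"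
      using C0(2)[OF t] C1 S z0 W1 unfolding T_def[symmetric]
      by (intro mult_left_mono mult_right_mono) auto
    also have "\<dots> = (C1 + 2 * S) * C0 * z * (exp (- c * t) * exp (c / 4 * t) * exp (c * t / 2)) * W"
      by (simp add: mult_ac)
    also have "exp (- c * t) * exp (c / 4 * t) * exp (c * t / 2) = exp (- c * t / 4)"
      by (simp add: exp_add[symmetric] algebra_simps)
    finally show "\<bar>exp (- t * \<phi>) * \<gamma> - laplace_model c F G N \<Omega> \<rho> t\<bar> \<le>
         (C1 + 2 * S) * C0 * (\<eta> + \<rho>) * \<rho> ^ N * exp (- c * t / 4) * (1 + ?G)"
      by (simp add: z_def W_def mult_ac)
  qed
qed

text \<open>
  Away from the origin every \<open>\<rho>\<^sup>j\<close> with \<open>j \<le> N\<close> is at most a constant times \<open>\<rho>\<^sup>N\<close>, so that the whole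
  truncated expansion is bounded by the same kind of weight as the error term.
\<close>

lemma laplace_model_tail:
  fixes c L \<delta> :: real and F G :: "nat \<Rightarrow> 'a \<Rightarrow> real"
  assumes c: "0 < c" and L: "0 \<le> L" and \<delta>: "0 < \<delta>"
  obtains C where "0 \<le> C"
    "\<And>\<Omega> \<rho> t.
       (\<Sum>n=1..N. \<bar>F n \<Omega>\<bar>) \<le> L \<Longrightarrow> \<delta> \<le> \<rho> \<Longrightarrow> 0 \<le> t \<Longrightarrow>
       \<bar>laplace_model c F G N \<Omega> \<rho> t\<bar> \<le> C * \<rho> ^ N * exp (- c * t / 2) * (1 + (\<Sum>j\<le>N. \<bar>G j \<Omega>\<bar>))"
proof -
  obtain C0 where C0: "1 \<le> C0" "\<And>t. 0 \<le> t \<Longrightarrow> (1 + t) ^ Suc N \<le> C0 * exp (c / 2 * t)"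
    using one_plus_power_le_exp[of "c / 2" "Suc N"] c by auto
  define S where "S = (\<Sum>r\<le>N. L ^ r)"
  define D where "D = (\<Sum>j\<le>N. (1 / \<delta>) ^ (N - j))"
  have S: "0 \<le> S" unfolding S_def using L by (intro sum_nonneg) auto
  have D: "0 \<le> D" unfolding D_def using \<delta> by (intro sum_nonneg) auto
  show ?thesis
  proof (rule that)
    show "0 \<le> D * C0 * S" using S D C0 by simp
    fix \<Omega> :: 'a and \<rho> t :: real
    assume FL: "(\<Sum>n=1..N. \<bar>F n \<Omega>\<bar>) \<le> L" and \<rho>: "\<delta> \<le> \<rho>" and t: "0 \<le> t"
    let ?e = "exp_coeff F \<Omega> t" and ?G = "\<Sum>j\<le>N. \<bar>G j \<Omega>\<bar>"
    have G0: "0 \<le> ?G" by (intro sum_nonneg) auto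
    have conv: "\<bar>convolution ?e (\<lambda>i. G i \<Omega>) j\<bar> \<le> C0 * exp (c / 2 * t) * S * (1 + ?G)" if "j \<le> N" for j
    proof -
      have "\<bar>convolution ?e (\<lambda>i. G i \<Omega>) j\<bar> \<le> (\<Sum>j\<le>N. \<bar>convolution ?e (\<lambda>i. G i \<Omega>) j\<bar>)"
        using that by (intro member_le_sum) auto
      also have "\<dots> \<le> (\<Sum>m\<le>N. \<bar>?e m\<bar>) * ?G" by (rule sum_abs_convolution_le)
      also have "\<dots> \<le> ((C0 * exp (c / 2 * t)) * S) * (1 + ?G)"
      proof (intro mult_mono)
        have "(\<Sum>m\<le>N. \<bar>?e m\<bar>) \<le> (1 + t) ^ Suc N * S"
          unfolding S_def by (rule sum_abs_exp_coeff_le[where F = F and \<Omega> = \<Omega>, OF FL t])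
        also have "\<dots> \<le> (C0 * exp (c / 2 * t)) * S" by (intro mult_right_mono C0 t S)
        finally show "(\<Sum>m\<le>N. \<bar>?e m\<bar>) \<le> (C0 * exp (c / 2 * t)) * S" .
      qed (use C0 S G0 in auto)
      finally show ?thesis .
    qed
    have pow: "\<rho> ^ j \<le> (1 / \<delta>) ^ (N - j) * \<rho> ^ N" if "j \<le> N" for j
    proof -
      have "\<rho> ^ j * 1 \<le> \<rho> ^ j * (\<rho> / \<delta>) ^ (N - j)"
        using \<rho> \<delta> by (intro mult_left_mono one_le_power) auto
      also have "\<dots> = (1 / \<delta>) ^ (N - j) * (\<rho> ^ j * \<rho> ^ (N - j))"
        by (simp add: power_divide)
      also have "\<rho> ^ j * \<rho> ^ (N - j) = \<rho> ^ N" using that by (simp add: power_add[symmetric])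
      finally show ?thesis by simp
    qed
    have "\<bar>\<Sum>j\<le>N. \<rho> ^ j * convolution ?e (\<lambda>i. G i \<Omega>) j\<bar> \<le>
        (\<Sum>j\<le>N. ((1 / \<delta>) ^ (N - j) * \<rho> ^ N) * (C0 * exp (c / 2 * t) * S * (1 + ?G)))"
    proof (rule order.trans[OF sum_abs], rule sum_mono)
      fix j assume "j \<in> {..N}"
      then show "\<bar>\<rho> ^ j * convolution ?e (\<lambda>i. G i \<Omega>) j\<bar> \<le>
          ((1 / \<delta>) ^ (N - j) * \<rho> ^ N) * (C0 * exp (c / 2 * t) * S * (1 + ?G))"
        unfolding abs_mult using \<rho> \<delta> by (intro mult_mono conv) (auto simp: power_abs pow)
    qed
    also have "\<dots> = (D * \<rho> ^ N) * (C0 * exp (c / 2 * t) * S * (1 + ?G))"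
      by (simp add: D_def sum_distrib_right)
    finally have "\<bar>laplace_model c F G N \<Omega> \<rho> t\<bar> \<le>
        exp (- c * t) * ((D * \<rho> ^ N) * (C0 * exp (c / 2 * t) * S * (1 + ?G)))"
      unfolding laplace_model_def abs_mult by simp
    also have "\<dots> = D * C0 * S * \<rho> ^ N * (exp (- c * t) * exp (c / 2 * t)) * (1 + ?G)"
      by (simp add: mult_ac)
    also have "exp (- c * t) * exp (c / 2 * t) = exp (- c * t / 2)"
      by (simp add: exp_add[symmetric] algebra_simps)
    finally show "\<bar>laplace_model c F G N \<Omega> \<rho> t\<bar> \<le> D * C0 * S * \<rho> ^ N * exp (- c * t / 2) * (1 + ?G)" .
  qed
qed

section \<open>Measurability and integrability of the coefficients\<close>

lemma integrable_lebesgue_scaleR: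
  fixes U :: "'a::euclidean_space \<Rightarrow> real"
  assumes U: "integrable lebesgue U" and s: "s \<noteq> 0"
  shows "integrable lebesgue (\<lambda>x. U (s *\<^sub>R x))"
proof -
  have eq: "(lebesgue :: 'a measure) = density (distr lebesgue lebesgue (\<lambda>x. s *\<^sub>R x)) (\<lambda>_. ennreal (\<bar>s\<bar> ^ DIM('a)))"
    using lebesgue_affine_euclidean[where c = "\<lambda>_::'a. s" and t = 0] s
    unfolding scaleR_scaleR[symmetric] scaleR_sum_right[symmetric] euclidean_representation prod_constant
    by (simp add: ennreal_power)
  have Um: "U \<in> borel_measurable lebesgue" using U by simp
  have "integrable (density (distr lebesgue lebesgue (\<lambda>x::'a. s *\<^sub>R x)) (\<lambda>_. ennreal (\<bar>s\<bar> ^ DIM('a)))) U"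
    using U by (subst (asm) eq)
  then have "integrable (distr lebesgue lebesgue (\<lambda>x::'a. s *\<^sub>R x)) (\<lambda>x. \<bar>s\<bar> ^ DIM('a) * U x)"
    by (subst (asm) integrable_density) (use Um in auto)
  then have "integrable lebesgue (\<lambda>x. \<bar>s\<bar> ^ DIM('a) * U (s *\<^sub>R x))"
    by (subst (asm) integrable_distr_eq) (use Um in auto)
  then show ?thesis using s by simp
qed

text \<open>
  Dividing the expansion by its leading power turns it into an approximation, uniform in the
  direction, by a polynomial in the radius.
\<close>

lemma polar_expansionD:
  fixes f P :: "'a::euclidean_space \<Rightarrow> real"
  assumes "(\<lambda>x. f x - norm x powr p * P x) \<in> o[at 0](\<lambda>x. norm x powr (real N + p))" and \<eta>: "0 < \<eta>"
  shows "\<forall>\<^sub>F x in at 0. \<bar>norm x powr (- p) * f x - P x\<bar> \<le> \<eta> * norm x ^ N"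
  using landau_o.smallD[OF assms] eventually_neq_at_within[of 0 0 UNIV]
proof eventually_elim
  case (elim x)
  have "\<bar>norm x powr (- p) * f x - P x\<bar> = norm x powr (- p) * \<bar>f x - norm x powr p * P x\<bar>"
    using elim(2) by (simp add: abs_mult[symmetric] powr_minus field_simps flip: abs_mult)
  also have "\<dots> \<le> norm x powr (- p) * (\<eta> * norm x powr (real N + p))"
    using elim(1) by (intro mult_left_mono) auto
  also have "\<dots> = \<eta> * norm x ^ N"
    using elim(2) by (simp add: powr_add powr_minus powr_realpow field_simps)
  finally show ?case .
qed

lemma filterlim_ray:
  fixes \<Omega> :: "'a::euclidean_space"
  assumes "\<Omega> \<in> sphere 0 1"
  shows "filterlim (\<lambda>\<rho>. \<rho> *\<^sub>R \<Omega>) (at 0) (at_right 0)"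
proof (rule filterlim_atI)
  have "((\<lambda>\<rho>. \<rho> *\<^sub>R \<Omega>) \<longlongrightarrow> 0 *\<^sub>R \<Omega>) (at_right 0)" by (intro tendsto_intros)
  then show "((\<lambda>\<rho>. \<rho> *\<^sub>R \<Omega>) \<longlongrightarrow> 0) (at_right 0)" by simp
  show "\<forall>\<^sub>F \<rho> in at_right 0. \<rho> *\<^sub>R \<Omega> \<noteq> 0"
    using eventually_at_right_less[of "0::real"] assms by (auto elim!: eventually_mono)
qed

text \<open>
  After division by \<open>\<rho>\<^sup>j\<close> the error still tends to \<open>0\<close>, since \<open>j \<le> N\<close>, and of the remaining polynomial only
  the constant term survives. The coefficients are thereby recovered from the function itself.
\<close>

lemma coefficient_tendsto:
  fixes a :: "nat \<Rightarrow> real"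
  assumes err: "\<And>\<eta>. 0 < \<eta> \<Longrightarrow> \<forall>\<^sub>F \<rho> in at_right 0. \<bar>h \<rho> - (\<Sum>i\<le>N. a i * \<rho> ^ i)\<bar> \<le> \<eta> * \<rho> ^ N"
    and j: "j \<le> N"
  shows "((\<lambda>\<rho>. (h \<rho> - (\<Sum>i<j. a i * \<rho> ^ i)) / \<rho> ^ j) \<longlongrightarrow> a j) (at_right 0)"
proof -
  have "((\<lambda>\<rho>. (h \<rho> - (\<Sum>i\<le>N. a i * \<rho> ^ i)) / \<rho> ^ j) \<longlongrightarrow> 0) (at_right 0)"
  proof (rule tendstoI)
    fix e :: real assume e: "0 < e"
    then have "0 < e / 2" by simp
    from err[OF this] eventually_at_right_less[of "0::real"] eventually_at_right_real[OF zero_less_one[where 'a = real]]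
    show "\<forall>\<^sub>F \<rho> in at_right 0. dist ((h \<rho> - (\<Sum>i\<le>N. a i * \<rho> ^ i)) / \<rho> ^ j) 0 < e"
    proof (eventually_elim)
      case (elim \<rho>)
      have "\<bar>h \<rho> - (\<Sum>i\<le>N. a i * \<rho> ^ i)\<bar> \<le> e / 2 * \<rho> ^ j"
        using elim e j by (intro order.trans[OF elim(1)] mult_left_mono power_decreasing) auto
      then have "\<bar>h \<rho> - (\<Sum>i\<le>N. a i * \<rho> ^ i)\<bar> / \<rho> ^ j \<le> e / 2"
        using elim by (simp add: divide_le_eq)
      also have "e / 2 < e" using e by simp
      finally show ?case using elim by (simp add: dist_real_def)
    qed
  qed
  moreover have "((\<lambda>\<rho>. \<Sum>i=j..N. a i * \<rho> ^ (i - j)) \<longlongrightarrow> (\<Sum>i=j..N. a i * 0 ^ (i - j))) (at_right 0)"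
    by (intro tendsto_intros)
  ultimately have "((\<lambda>\<rho>. (h \<rho> - (\<Sum>i\<le>N. a i * \<rho> ^ i)) / \<rho> ^ j + (\<Sum>i=j..N. a i * \<rho> ^ (i - j))) \<longlongrightarrow>
      0 + (\<Sum>i=j..N. a i * 0 ^ (i - j))) (at_right 0)"
    by (rule tendsto_add)
  moreover have "(\<Sum>i=j..N. a i * 0 ^ (i - j)) = a j"
  proof -
    have "{j..N} = insert j {Suc j..N}" using j by auto
    moreover have "(\<Sum>i=Suc j..N. a i * 0 ^ (i - j)) = 0" by (intro sum.neutral) auto
    ultimately show ?thesis by simp
  qed
  moreover have "\<forall>\<^sub>F \<rho> in at_right 0. (h \<rho> - (\<Sum>i\<le>N. a i * \<rho> ^ i)) / \<rho> ^ j + (\<Sum>i=j..N. a i * \<rho> ^ (i - j)) =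
      (h \<rho> - (\<Sum>i<j. a i * \<rho> ^ i)) / \<rho> ^ j"
    using eventually_at_right_less[of "0::real"]
  proof eventually_elim
    case (elim \<rho>)
    have "{..N} = {..<j} \<union> {j..N}" using j by auto
    then have "(\<Sum>i\<le>N. a i * \<rho> ^ i) = (\<Sum>i<j. a i * \<rho> ^ i) + (\<Sum>i=j..N. a i * \<rho> ^ i)"
      by (simp only:) (rule sum.union_disjoint, auto)
    also have "(\<Sum>i=j..N. a i * \<rho> ^ i) = \<rho> ^ j * (\<Sum>i=j..N. a i * \<rho> ^ (i - j))"
      unfolding sum_distrib_left by (intro sum.cong) (auto simp: power_add[symmetric] mult.left_commute)
    finally show ?case using elim by (simp add: field_simps)
  qed
  ultimately have "((\<lambda>\<rho>. (h \<rho> - (\<Sum>i<j. a i * \<rho> ^ i)) / \<rho> ^ j) \<longlongrightarrow> 0 + a j) (at_right 0)"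
    by (simp only: Lim_transform_eventually)
  then show ?thesis by simp
qed

lemma polar_expansion_ray:
  fixes f :: "'a::euclidean_space \<Rightarrow> real"
  assumes f: "(\<lambda>x. f x - norm x powr p * (\<Sum>j\<le>N. A j (x /\<^sub>R norm x) * norm x ^ j))
        \<in> o[at 0](\<lambda>x. norm x powr (real N + p))"
    and \<Omega>: "\<Omega> \<in> sphere 0 1" and \<eta>: "0 < \<eta>"
  shows "\<forall>\<^sub>F \<rho> in at_right 0. \<bar>\<rho> powr (- p) * f (\<rho> *\<^sub>R \<Omega>) - (\<Sum>j\<le>N. A j \<Omega> * \<rho> ^ j)\<bar> \<le> \<eta> * \<rho> ^ N"
  using eventually_compose_filterlim[OF polar_expansionD[OF f \<eta>] filterlim_ray[OF \<Omega>]]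
    eventually_at_right_less[of "0::real"]
  by eventually_elim (use \<Omega> in simp)

text \<open>
  Along the ray of direction \<open>\<Omega>\<close> the quotient tends to \<open>A 0 \<Omega>\<close>, and the limit at the origin is the
  same for all rays.
\<close>

lemma leading_coefficient_constant:
  fixes f :: "'a::euclidean_space \<Rightarrow> real"
  assumes f: "(\<lambda>x. f x - norm x powr p * (\<Sum>j\<le>N. A j (x /\<^sub>R norm x) * norm x ^ j))
        \<in> o[at 0](\<lambda>x. norm x powr (real N + p))"
    and lim: "((\<lambda>x. norm x powr (- p) * f x) \<longlongrightarrow> L) (at 0)" and \<Omega>: "\<Omega> \<in> sphere 0 1"
  shows "A 0 \<Omega> = L"
proof -
  have "((\<lambda>\<rho>. norm (\<rho> *\<^sub>R \<Omega>) powr (- p) * f (\<rho> *\<^sub>R \<Omega>)) \<longlongrightarrow> L) (at_right 0)"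
    by (rule filterlim_compose[OF lim filterlim_ray[OF \<Omega>]])
  moreover have "\<forall>\<^sub>F \<rho> in at_right 0. norm (\<rho> *\<^sub>R \<Omega>) powr (- p) * f (\<rho> *\<^sub>R \<Omega>) = \<rho> powr (- p) * f (\<rho> *\<^sub>R \<Omega>)"
    using eventually_at_right_less[of "0::real"] by eventually_elim (use \<Omega> in simp)
  ultimately have "((\<lambda>\<rho>. \<rho> powr (- p) * f (\<rho> *\<^sub>R \<Omega>)) \<longlongrightarrow> L) (at_right 0)"
    by (rule Lim_transform_eventually)
  moreover have "((\<lambda>\<rho>. (\<rho> powr (- p) * f (\<rho> *\<^sub>R \<Omega>) - (\<Sum>i<0. A i \<Omega> * \<rho> ^ i)) / \<rho> ^ 0) \<longlongrightarrow> A 0 \<Omega>) (at_right 0)"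
    by (rule coefficient_tendsto[OF polar_expansion_ray[OF f \<Omega>]]) auto
  then have "((\<lambda>\<rho>. \<rho> powr (- p) * f (\<rho> *\<^sub>R \<Omega>)) \<longlongrightarrow> A 0 \<Omega>) (at_right 0)"
    by simp
  ultimately show ?thesis
    using tendsto_unique[OF trivial_limit_at_right_real] by metis
qed

text \<open>
  Evaluating \<open>g\<close> along \<open>x / 2\<^sup>n\<close> exhibits \<open>G j (x /\<^sub>R norm x)\<close> as a limit of Lebesgue measurable functions of
  \<open>x\<close>, once the lower coefficients are known to be measurable.
\<close>

lemma coefficient_measurable:
  fixes g :: "'a::euclidean_space \<Rightarrow> real"
  assumes R: "R \<in> sets lebesgue" "0 \<in> interior R" and g: "g \<in> borel_measurable (lebesgue_on R)"
    and exp: "(\<lambda>x. g x - norm x powr p * (\<Sum>j\<le>N. G j (x /\<^sub>R norm x) * norm x ^ j))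
        \<in> o[at 0](\<lambda>x. norm x powr (real N + p))"
    and j: "j \<le> N"
  shows "G j \<in> borel_measurable surface_measure"
  using j
proof (induction j rule: less_induct)
  case (less j)
  let ?M = "lebesgue_on (-{0::'a})"
  define s where "s n = (1 / 2 :: real) ^ n" for n
  \<comment> \<open>Extension by zero makes \<open>g\<close> measurable on the whole space; only values near the origin matter.\<close>
  define g' where "g' x = (if x \<in> R then g x else 0)" for x
  have s: "0 < s n" for n by (simp add: s_def)
  have s0: "s \<longlonglongrightarrow> 0" unfolding s_def by (rule LIMSEQ_realpow_zero) auto
  have g': "g' \<in> borel_measurable lebesgue"
    unfolding g'_def by (rule borel_measurable_if_I[OF g R(1)])
  let ?u = "\<lambda>n x. ((s n * norm x) powr (- p) * g' (s n *\<^sub>R x) -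
      (\<Sum>i<j. G i (x /\<^sub>R norm x) * (s n * norm x) ^ i)) / (s n * norm x) ^ j"
  have "(\<lambda>x. G j (x /\<^sub>R norm x)) \<in> borel_measurable ?M"
  proof (rule borel_measurable_LIMSEQ_real)
    fix n
    have nm: "(norm :: 'a \<Rightarrow> real) \<in> borel_measurable ?M"
      by (intro measurable_restrict_space1 measurable_completion) simp
    have "(\<lambda>x. g' (s n *\<^sub>R x)) \<in> borel_measurable ?M"
      by (intro measurable_restrict_space1 measurable_compose[OF lebesgue_measurable_scaling g'])
    moreover have "(\<lambda>x. G i (x /\<^sub>R norm x)) \<in> borel_measurable ?M" if "i < j" for i
      using less that by (intro measurable_compose[OF direction_measurable]) auto
    ultimately show "?u n \<in> borel_measurable ?M"
      using nm by (intro borel_measurable_divide borel_measurable_diff borel_measurable_times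
          borel_measurable_sum borel_measurable_power powr_real_measurable) auto
  next
    fix x :: 'a
    assume "x \<in> space ?M"
    then have x: "x \<noteq> 0" by auto
    define \<Omega> where "\<Omega> = x /\<^sub>R norm x"
    have \<Omega>: "\<Omega> \<in> sphere 0 1" using x by (simp add: \<Omega>_def)
    have nx: "norm x *\<^sub>R \<Omega> = x" using x by (simp add: \<Omega>_def)
    have lim: "((\<lambda>\<rho>. (\<rho> powr (- p) * g (\<rho> *\<^sub>R \<Omega>) - (\<Sum>i<j. G i \<Omega> * \<rho> ^ i)) / \<rho> ^ j) \<longlongrightarrow> G j \<Omega>) (at_right 0)"
      by (rule coefficient_tendsto[OF polar_expansion_ray[OF exp \<Omega>] less.prems])
    have "((\<lambda>n. s n * norm x) \<longlongrightarrow> 0 * norm x) sequentially"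
      by (intro tendsto_intros s0)
    then have flt: "filterlim (\<lambda>n. s n * norm x) (at_right 0) sequentially"
      using s x by (intro tendsto_imp_filterlim_at_right) auto
    have "\<forall>\<^sub>F y in at 0. y \<in> R"
      by (rule eventually_mono[OF eventually_at_in_open'[OF open_interior R(2)]])
         (use interior_subset in blast)
    then have "\<forall>\<^sub>F n in sequentially. (s n * norm x) *\<^sub>R \<Omega> \<in> R"
      by (intro eventually_compose_filterlim[OF _ filterlim_compose[OF filterlim_ray[OF \<Omega>] flt]])
    then have ev: "\<forall>\<^sub>F n in sequentially. ((s n * norm x) powr (- p) * g ((s n * norm x) *\<^sub>R \<Omega>) -
        (\<Sum>i<j. G i \<Omega> * (s n * norm x) ^ i)) / (s n * norm x) ^ j = ?u n x"
    proof eventually_elim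
      case (elim n)
      have "(s n * norm x) *\<^sub>R \<Omega> = s n *\<^sub>R x" using nx by (metis scaleR_scaleR)
      with elim show ?case by (simp add: g'_def \<Omega>_def[symmetric])
    qed
    show "(\<lambda>n. ?u n x) \<longlonglongrightarrow> G j (x /\<^sub>R norm x)"
      unfolding \<Omega>_def[symmetric]
      using filterlim_compose[OF lim flt] ev unfolding \<Omega>_def[symmetric]
      by (rule Lim_transform_eventually)
  qed
  then show ?case by (rule borel_measurable_surface_measureI)
qed

text \<open>
  Let \<open>U\<close> be the integrable function in the hypothesis. Its summands are homogeneous of the degrees
  \<open>p + i\<close>, so in \<open>U(x) - 2\<^sup>p\<^sup>+\<^sup>q U(x/2)\<close> the summand of index \<open>q\<close> cancels, while every other one is multiplied
  by the nonzero factor \<open>1 - 2\<^sup>q\<^sup>-\<^sup>i\<close>. Hence the index set can be shrunk to the single element \<open>j\<close>.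
\<close>

lemma homogeneous_components_integrable:
  fixes G :: "nat \<Rightarrow> 'a::euclidean_space \<Rightarrow> real"
  assumes "finite J" and \<delta>: "0 < \<delta>"
    and "\<And>j. j \<in> J \<Longrightarrow> G j \<in> borel_measurable surface_measure"
    and "integrable lebesgue (\<lambda>x. indicator (ball 0 \<delta>) x * norm x powr p * (\<Sum>j\<in>J. G j (x /\<^sub>R norm x) * norm x ^ j))"
    and "j \<in> J"
  shows "integrable surface_measure (G j)"
  using assms(1,3-)
proof (induction J arbitrary: G j rule: finite_psubset_induct)
  case (psubset J)
  let ?U = "\<lambda>x. indicator (ball 0 \<delta>) x * norm x powr p * (\<Sum>j\<in>J. G j (x /\<^sub>R norm x) * norm x ^ j)"
  show ?case
  proof (cases "J = {j}")
    case True
    let ?h = "\<lambda>\<rho>::real. indicator {0<..<\<delta>} \<rho> * \<rho> powr p * \<rho> ^ j"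
    have "integrable lebesgue (\<lambda>x. ?h (norm x) * G j (x /\<^sub>R norm x))"
      using psubset.prems(2) unfolding True
      by (elim back_subst[where P = "integrable lebesgue"]) (auto simp: fun_eq_iff split: split_indicator)
    moreover have "(\<integral>\<^sup>+\<rho>. ennreal (?h \<rho>) \<partial>radius_measure TYPE('a)) \<noteq> 0"
    proof
      assume "(\<integral>\<^sup>+\<rho>. ennreal (?h \<rho>) \<partial>radius_measure TYPE('a)) = 0"
      then have "AE \<rho> in radius_measure TYPE('a). ennreal (?h \<rho>) = 0"
        by (subst (asm) nn_integral_0_iff_AE) auto
      then have "AE \<rho> in lborel. 0 < indicator {0<..} \<rho> * ennreal (\<rho> ^ (DIM('a) - 1)) \<longrightarrow> ennreal (?h \<rho>) = 0"
        unfolding radius_measure_def by (subst (asm) AE_density) auto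
      then have "AE \<rho> in lborel. \<rho> \<notin> {0<..<\<delta>}"
      proof eventually_elim
        case (elim \<rho>)
        show ?case
        proof
          assume \<rho>: "\<rho> \<in> {0<..<\<delta>}"
          with elim have "ennreal (?h \<rho>) = 0" by simp
          moreover have "0 < ?h \<rho>" using \<rho> by simp
          ultimately show False by (metis ennreal_eq_0_iff not_le)
        qed
      qed
      then have "emeasure lborel {0<..<\<delta>} = 0"
        by (subst (asm) AE_iff_measurable[where N = "{0<..<\<delta>}"]) auto
      then show False using \<delta> by simp
    qed
    ultimately show ?thesis
      using psubset.prems(1)[of j] True
      by (intro integrable_angular[of ?h]) (auto simp: indicator_def)
  next
    case False
    then obtain q where q: "q \<in> J" "q \<noteq> j" using psubset.prems(3) by blast
    let ?b = "\<lambda>i. 1 - 2 powr (real q - real i)"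
    have half: "integrable lebesgue (\<lambda>x. ?U ((1 / 2) *\<^sub>R x))"
      by (rule integrable_lebesgue_scaleR[OF psubset.prems(2)]) simp
    have ball: "ball (0::'a) \<delta> \<in> sets lebesgue" by simp
    have "integrable lebesgue (\<lambda>x. ?U x - 2 powr (p + real q) * (indicator (ball 0 \<delta>) x *\<^sub>R ?U ((1 / 2) *\<^sub>R x)))"
      by (intro Bochner_Integration.integrable_diff psubset.prems(2) integrable_mult_right
          integrable_mult_indicator ball half)
    moreover have "?U x - 2 powr (p + real q) * (indicator (ball 0 \<delta>) x *\<^sub>R ?U ((1 / 2) *\<^sub>R x)) =
        indicator (ball 0 \<delta>) x * norm x powr p * (\<Sum>i\<in>J - {q}. (?b i * G i (x /\<^sub>R norm x)) * norm x ^ i)" for x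
    proof (cases "x \<in> ball 0 \<delta> \<and> x \<noteq> 0")
      case True
      then have x: "norm x < \<delta>" "x \<noteq> 0" by auto
      have hx: "(1 / 2) *\<^sub>R x \<in> ball 0 \<delta>" using x \<delta> by simp
      have dir: "((1 / 2) *\<^sub>R x) /\<^sub>R norm ((1 / 2) *\<^sub>R x) = x /\<^sub>R norm x" by (simp add: inverse_eq_divide)
      have np: "norm ((1 / 2) *\<^sub>R x) powr p = 2 powr (- p) * norm x powr p"
        by (simp add: powr_divide powr_minus field_simps)
      have ni: "norm ((1 / 2) *\<^sub>R x) ^ i = 2 powr (- real i) * norm x ^ i" for i
        by (simp add: powr_minus powr_realpow power_divide field_simps)
      have "2 powr (p + real q) * ?U ((1 / 2) *\<^sub>R x) =
          norm x powr p * (2 powr (p + real q) * 2 powr (- p)) * (\<Sum>i\<in>J. G i (x /\<^sub>R norm x) * (2 powr (- real i) * norm x ^ i))"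
        using hx unfolding dir np ni by simp
      also have "2 powr (p + real q) * 2 powr (- p) = 2 powr real q"
        by (simp add: powr_add[symmetric])
      also have "norm x powr p * 2 powr real q * (\<Sum>i\<in>J. G i (x /\<^sub>R norm x) * (2 powr (- real i) * norm x ^ i)) =
          norm x powr p * (\<Sum>i\<in>J. 2 powr (real q - real i) * G i (x /\<^sub>R norm x) * norm x ^ i)"
        by (simp add: sum_distrib_left powr_diff powr_minus field_simps)
      finally have "?U x - 2 powr (p + real q) * (indicator (ball 0 \<delta>) x *\<^sub>R ?U ((1 / 2) *\<^sub>R x)) =
          norm x powr p * ((\<Sum>i\<in>J. G i (x /\<^sub>R norm x) * norm x ^ i) -
            (\<Sum>i\<in>J. 2 powr (real q - real i) * G i (x /\<^sub>R norm x) * norm x ^ i))"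
        using True by (simp add: right_diff_distrib)
      also have "(\<Sum>i\<in>J. G i (x /\<^sub>R norm x) * norm x ^ i) -
            (\<Sum>i\<in>J. 2 powr (real q - real i) * G i (x /\<^sub>R norm x) * norm x ^ i) =
          (\<Sum>i\<in>J. (?b i * G i (x /\<^sub>R norm x)) * norm x ^ i)"
        by (simp add: sum_subtractf[symmetric] left_diff_distrib)
      also have "\<dots> = (\<Sum>i\<in>J - {q}. (?b i * G i (x /\<^sub>R norm x)) * norm x ^ i)"
        using q(1) psubset.hyps by (subst sum.remove[of J q]) auto
      finally show ?thesis using True by simp
    qed (auto split: split_indicator)
    ultimately have "integrable lebesgue (\<lambda>x. indicator (ball 0 \<delta>) x * norm x powr p *
        (\<Sum>i\<in>J - {q}. (?b i * G i (x /\<^sub>R norm x)) * norm x ^ i))"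
      by (simp only:)
    from psubset.IH[OF _ _ this, of j] have "integrable surface_measure (\<lambda>\<Omega>. ?b j * G j \<Omega>)"
      using q psubset.prems by auto
    moreover have "?b j \<noteq> 0" using q(2) by simp
    ultimately show ?thesis by simp
  qed
qed

lemma integrable_const_surface_measure: "integrable surface_measure (\<lambda>_. c :: real)"
proof -
  interpret finite_measure "sphere_borel :: 'a measure" by (rule finite_measure_sphere_borel)
  have "integrable (sphere_borel :: 'a measure) (\<lambda>_. c)" by simp
  then show ?thesis unfolding surface_measure_eq_completion by (subst integrable_completion) auto
qed

text \<open>
  Near the origin \<open>\<Sum>\<^sub>j G\<^sub>j(x/|x|) |x|\<^sup>j\<^sup>+\<^sup>l\<^sup>-\<^sup>d\<close> differs from the integrable function \<open>g\<close> by at most \<open>|x|\<^sup>N\<^sup>+\<^sup>l\<^sup>-\<^sup>d\<close>, which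
  is integrable because \<open>l > 0\<close>.
\<close>

lemma coefficient_integrable:
  fixes g :: "'a::euclidean_space \<Rightarrow> real"
  assumes R: "R \<in> sets lebesgue" "0 \<in> interior R" and g: "g \<in> borel_measurable (lebesgue_on R)"
    and exp: "(\<lambda>x. g x - norm x powr (l - real DIM('a)) * (\<Sum>j\<le>N. G j (x /\<^sub>R norm x) * norm x ^ j))
        \<in> o[at 0](\<lambda>x. norm x powr (real N + (l - real DIM('a))))"
    and l: "0 < l" and \<delta>0: "0 < \<delta>0" "ball 0 \<delta>0 \<subseteq> R"
    and int: "integrable lebesgue (\<lambda>x. indicator (ball 0 \<delta>0) x * g x)"
    and j: "j \<le> N"
  shows "integrable surface_measure (G j)"
proof -
  let ?p = "l - real DIM('a)"
  let ?P = "\<lambda>x. \<Sum>j\<le>N. G j (x /\<^sub>R norm x) * norm x ^ j"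
  have Gm: "G j \<in> borel_measurable surface_measure" if "j \<le> N" for j
    by (rule coefficient_measurable[OF R g exp that])
  obtain \<delta>1 where \<delta>1: "0 < \<delta>1"
      "\<And>x. x \<noteq> 0 \<Longrightarrow> norm x < \<delta>1 \<Longrightarrow> \<bar>norm x powr (- ?p) * g x - ?P x\<bar> \<le> 1 * norm x ^ N"
    using polar_expansionD[OF exp zero_less_one] unfolding eventually_at by (auto simp: dist_norm)
  define \<delta> where "\<delta> = min \<delta>0 (min \<delta>1 1)"
  have \<delta>: "0 < \<delta>" "\<delta> \<le> \<delta>0" "\<delta> \<le> \<delta>1" "\<delta> \<le> 1" using \<delta>0 \<delta>1 by (auto simp: \<delta>_def)
  have int1: "integrable lebesgue (\<lambda>x::'a. norm x powr (l + real N - real DIM('a)) * exp (- 1 * norm x powr 1) * 1)"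
    using l by (intro has_bochner_integral_powr_exp_angular[THEN integrable.intros] integrable_const_surface_measure) auto
  have "integrable lebesgue (\<lambda>x. indicator (ball 0 \<delta>) x * norm x powr ?p * ?P x)"
  proof (rule Bochner_Integration.integrable_bound)
    show "integrable lebesgue (\<lambda>x::'a. \<bar>indicator (ball 0 \<delta>0) x * g x\<bar> +
        exp 1 * (norm x powr (l + real N - real DIM('a)) * exp (- 1 * norm x powr 1) * 1))"
      by (intro Bochner_Integration.integrable_add integrable_abs int integrable_mult_right int1)
    have "(\<lambda>x. \<Sum>j\<le>N. (indicator {0<..<\<delta>} (norm x) * norm x powr ?p * norm x ^ j) * G j (x /\<^sub>R norm x)) \<in> borel_measurable lebesgue"
      by (intro borel_measurable_sum radial_times_angular_measurable[where h = "\<lambda>\<rho>. indicator {0<..<\<delta>} \<rho> * \<rho> powr ?p * \<rho> ^ _"]) (auto intro: Gm)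
    also have "(\<lambda>x::'a. \<Sum>j\<le>N. (indicator {0<..<\<delta>} (norm x) * norm x powr ?p * norm x ^ j) * G j (x /\<^sub>R norm x)) =
        (\<lambda>x. indicator (ball 0 \<delta>) x * norm x powr ?p * ?P x)"
      by (rule ext) (auto simp: sum_distrib_left mult_ac split: split_indicator)
    finally show "(\<lambda>x. indicator (ball 0 \<delta>) x * norm x powr ?p * ?P x) \<in> borel_measurable lebesgue" .
    show "AE x in lebesgue. norm (indicator (ball 0 \<delta>) x * norm x powr ?p * ?P x) \<le>
        norm (\<bar>indicator (ball 0 \<delta>0) x * g x\<bar> +
          exp 1 * (norm x powr (l + real N - real DIM('a)) * exp (- 1 * norm x powr 1) * 1))"
    proof (rule always_eventually, rule allI)
      fix x :: 'a
      show "norm (indicator (ball 0 \<delta>) x * norm x powr ?p * ?P x) \<le>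
        norm (\<bar>indicator (ball 0 \<delta>0) x * g x\<bar> +
          exp 1 * (norm x powr (l + real N - real DIM('a)) * exp (- 1 * norm x powr 1) * 1))"
      proof (cases "x \<in> ball 0 \<delta> \<and> x \<noteq> 0")
        case True
        then have x: "norm x < \<delta>" "x \<noteq> 0" by auto
        have "\<bar>?P x\<bar> \<le> norm x powr (- ?p) * \<bar>g x\<bar> + norm x ^ N"
          using \<delta>1(2)[of x] x \<delta> abs_triangle_ineq2[of "?P x" "norm x powr (- ?p) * g x"]
          by (simp add: abs_mult abs_minus_commute)
        then have "norm x powr ?p * \<bar>?P x\<bar> \<le> norm x powr ?p * (norm x powr (- ?p) * \<bar>g x\<bar> + norm x ^ N)"
          by (intro mult_left_mono) auto
        also have "\<dots> = \<bar>g x\<bar> + norm x powr (l + real N - real DIM('a)) * 1"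
        proof -
          have "norm x powr ?p * norm x powr (- ?p) = 1"
            using x by (simp add: powr_add[symmetric])
          moreover have "norm x powr ?p * norm x ^ N = norm x powr (l + real N - real DIM('a))"
            using x by (simp add: powr_realpow[symmetric] powr_add[symmetric] algebra_simps)
          ultimately show ?thesis by (simp only: distrib_left mult.assoc[symmetric] mult_1_left mult_1_right)
        qed
        also have "\<dots> \<le> \<bar>g x\<bar> + norm x powr (l + real N - real DIM('a)) * (exp 1 * exp (- norm x))"
          using x \<delta> by (intro add_left_mono mult_left_mono) (auto simp: exp_add[symmetric])
        finally show ?thesis using True \<delta> by (simp add: abs_mult mult_ac)
      qed (auto split: split_indicator)
    qed
  qed
  then show ?thesis
    using homogeneous_components_integrable[where J = "{..N}" and G = G and \<delta> = \<delta> and j = j] \<delta>(1) j Gm by auto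
qed

lemma continuous_on_comp_sum:
  assumes "\<And>n. n \<le> m \<Longrightarrow> continuous_on S (F n)"
  shows "continuous_on S (comp_sum F m r)"
  using assms
proof (induction r arbitrary: m)
  case 0
  then show ?case by (simp add: comp_sum_0[abs_def])
next
  case (Suc r)
  then show ?case
    unfolding comp_sum_Suc[abs_def] by (intro continuous_intros) auto
qed

lemma integrable_mult_continuous_surface_measure:
  fixes G h :: "'a::euclidean_space \<Rightarrow> real"
  assumes G: "integrable surface_measure G" and h: "continuous_on (sphere 0 1) h"
  shows "integrable surface_measure (\<lambda>\<Omega>. G \<Omega> * h \<Omega>)"
proof -
  have "bounded (h ` sphere 0 1)"
    by (intro compact_imp_bounded compact_continuous_image h) auto
  then obtain K where "\<forall>\<Omega>\<in>sphere 0 1. \<bar>h \<Omega>\<bar> \<le> K"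
    unfolding bounded_iff by auto
  then have K: "\<bar>h \<Omega>\<bar> \<le> K" if "\<Omega> \<in> sphere 0 1" for \<Omega> using that by blast
  have "h \<in> borel_measurable sphere_borel"
    using borel_measurable_continuous_on_restrict[OF h]
    by (subst measurable_cong_sets[OF sets_sphere_borel refl])
  then have hm: "h \<in> borel_measurable surface_measure"
    unfolding surface_measure_eq_completion by (rule measurable_completion)
  show ?thesis
  proof (rule Bochner_Integration.integrable_bound)
    show "integrable surface_measure (\<lambda>\<Omega>. K * \<bar>G \<Omega>\<bar>)" using G by simp
    show "(\<lambda>\<Omega>. G \<Omega> * h \<Omega>) \<in> borel_measurable surface_measure" using G hm by simp
    show "AE \<Omega> in surface_measure. norm (G \<Omega> * h \<Omega>) \<le> norm (K * \<bar>G \<Omega>\<bar>)"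
    proof (rule AE_I2)
      fix \<Omega> :: 'a assume "\<Omega> \<in> space surface_measure"
      then have "\<bar>h \<Omega>\<bar> \<le> K" using K by auto
      then show "norm (G \<Omega> * h \<Omega>) \<le> norm (K * \<bar>G \<Omega>\<bar>)"
        using mult_right_mono[of "\<bar>h \<Omega>\<bar>" K "\<bar>G \<Omega>\<bar>"] by (simp add: abs_mult mult.commute)
    qed
  qed
qed

section \<open>The integral of the truncated expansion\<close>

lemma Gamma_shift_gbinomial:
  fixes \<alpha> :: real
  assumes "0 < \<alpha>"
  shows "(- 1) ^ r / fact r * Gamma (\<alpha> + real r) = Gamma \<alpha> * ((- \<alpha>) gchoose r)"
proof -
  have "\<alpha> \<notin> \<int>\<^sub>\<le>\<^sub>0" using assms by (auto elim!: nonpos_Ints_cases)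
  then have "pochhammer \<alpha> r = Gamma (\<alpha> + real r) / Gamma \<alpha>" by (rule pochhammer_Gamma)
  moreover have "Gamma \<alpha> > 0" using assms by (rule Gamma_real_pos)
  ultimately show ?thesis by (simp add: gbinomial_pochhammer field_simps)
qed

text \<open>
  Expanding the model gives terms \<open>|x|\<^sup>a\<^sup>-\<^sup>d exp (- c k |x|\<^sup>\<nu>) w(x/|x|)\<close> with \<open>a = l + j + \<nu> r\<close> and a factor \<open>k\<^sup>r\<close>. The
  Gamma integral contributes \<open>k powr (- (l + j) / \<nu> - r)\<close>, so the powers of \<open>k\<close> combine to the same exponent for
  all \<open>r\<close>.
\<close>

lemma has_bochner_integral_laplace_model:
  fixes F G :: "nat \<Rightarrow> 'a::euclidean_space \<Rightarrow> real"
  assumes c: "0 < c" and \<nu>: "0 < \<nu>" and l: "0 < l" and k: "0 < k"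
    and G: "\<And>j. j \<le> N \<Longrightarrow> integrable surface_measure (G j)"
    and GF: "\<And>j m r. j \<le> N \<Longrightarrow> m \<le> j \<Longrightarrow> integrable surface_measure (\<lambda>\<Omega>. G (j - m) \<Omega> * comp_sum F m r \<Omega>)"
  shows "has_bochner_integral lebesgue
     (\<lambda>x. norm x powr (l - real DIM('a)) * laplace_model c F G N (x /\<^sub>R norm x) (norm x) (k * norm x powr \<nu>))
     (\<Sum>j\<le>N. zeta_coeff \<nu> l c F G j * k powr (- (real j + l) / \<nu>))"
proof -
  let ?I = "\<lambda>j m r. LINT \<Omega>|surface_measure. G (j - m) \<Omega> * comp_sum F m r \<Omega>"
  let ?a = "\<lambda>j r. l + real j + \<nu> * real r"
  let ?t = "\<lambda>j m r x. (- k) ^ r / fact r * (norm x powr (?a j r - real DIM('a)) * exp (- (c * k) * norm x powr \<nu>) *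
      (G (j - m) (x /\<^sub>R norm x) * comp_sum F m r (x /\<^sub>R norm x)))"
  let ?v = "\<lambda>j m r. (- k) ^ r / fact r * (Gamma (?a j r / \<nu>) * (c * k) powr (- ?a j r / \<nu>) / \<nu> * ?I j m r)"
  have "has_bochner_integral lebesgue (\<lambda>x. \<Sum>j\<le>N. \<Sum>m\<le>j. \<Sum>r\<le>m. ?t j m r x) (\<Sum>j\<le>N. \<Sum>m\<le>j. \<Sum>r\<le>m. ?v j m r)"
    using c k \<nu> l
    by (intro has_bochner_integral_sum has_bochner_integral_mult_right has_bochner_integral_powr_exp_angular GF)
       (auto intro!: add_pos_nonneg)
  moreover have "(\<lambda>x. \<Sum>j\<le>N. \<Sum>m\<le>j. \<Sum>r\<le>m. ?t j m r x) =
      (\<lambda>x. norm x powr (l - real DIM('a)) * laplace_model c F G N (x /\<^sub>R norm x) (norm x) (k * norm x powr \<nu>))"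
  proof (rule ext)
    fix x :: 'a
    show "(\<Sum>j\<le>N. \<Sum>m\<le>j. \<Sum>r\<le>m. ?t j m r x) =
        norm x powr (l - real DIM('a)) * laplace_model c F G N (x /\<^sub>R norm x) (norm x) (k * norm x powr \<nu>)"
    proof (cases "x = 0")
      case False
      have "?t j m r x = norm x powr (l - real DIM('a)) * (exp (- c * (k * norm x powr \<nu>)) *
          (norm x ^ j * ((- (k * norm x powr \<nu>)) ^ r / fact r * comp_sum F m r (x /\<^sub>R norm x) * G (j - m) (x /\<^sub>R norm x))))"
        for j m r
      proof -
        have "norm x powr (?a j r - real DIM('a)) = norm x powr (l - real DIM('a)) * (norm x ^ j * (norm x powr \<nu>) ^ r)"
          using False by (simp add: powr_realpow[symmetric] powr_powr powr_add[symmetric] algebra_simps)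
        moreover have "(- (k * norm x powr \<nu>)) ^ r = (- k) ^ r * (norm x powr \<nu>) ^ r"
          by (simp only: power_mult_distrib[symmetric] mult_minus_left)
        ultimately show ?thesis by (simp add: mult_ac)
      qed
      then have "(\<Sum>j\<le>N. \<Sum>m\<le>j. \<Sum>r\<le>m. ?t j m r x) = (\<Sum>j\<le>N. \<Sum>m\<le>j. \<Sum>r\<le>m.
          norm x powr (l - real DIM('a)) * (exp (- c * (k * norm x powr \<nu>)) *
          (norm x ^ j * ((- (k * norm x powr \<nu>)) ^ r / fact r * comp_sum F m r (x /\<^sub>R norm x) * G (j - m) (x /\<^sub>R norm x)))))"
        by (intro sum.cong refl)
      then show ?thesis
        unfolding laplace_model_def convolution_def exp_coeff_def sum_distrib_left sum_distrib_right .
    qed simp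
  qed
  moreover have "(\<Sum>m\<le>j. \<Sum>r\<le>m. ?v j m r) = zeta_coeff \<nu> l c F G j * k powr (- (real j + l) / \<nu>)" for j
  proof -
    define \<alpha> where "\<alpha> = (real j + l) / \<nu>"
    have \<alpha>: "0 < \<alpha>" using \<nu> l by (simp add: \<alpha>_def add_nonneg_pos)
    have v: "?v j m r = 1 / \<nu> * Gamma \<alpha> * c powr (- \<alpha>) * (((- \<alpha>) gchoose r) * c powr (- real r) * ?I j m r) * k powr (- \<alpha>)" for m r
    proof -
      have "?a j r / \<nu> = \<alpha> + real r" "- ?a j r / \<nu> = - \<alpha> + - real r"
        using \<nu> by (simp_all add: \<alpha>_def field_simps)
      then have "?v j m r = (k ^ r * k powr (- real r)) * ((- 1) ^ r / fact r * Gamma (\<alpha> + real r)) *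
          c powr (- \<alpha>) * c powr (- real r) * k powr (- \<alpha>) / \<nu> * ?I j m r"
        using c k by (simp only: powr_mult less_imp_le powr_add power_minus[of k]) (simp add: mult_ac)
      also have "k ^ r * k powr (- real r) = 1"
        using k by (simp add: powr_minus powr_realpow)
      finally show ?thesis unfolding Gamma_shift_gbinomial[OF \<alpha>] by (simp add: mult_ac)
    qed
    have "(\<Sum>r\<le>m. ?v j m r) = 1 / \<nu> * Gamma \<alpha> * c powr (- \<alpha>) * (if m = 0 then integral\<^sup>L surface_measure (G j)
        else (\<Sum>r=1..m. ((- \<alpha>) gchoose r) * c powr (- real r) * ?I j m r)) * k powr (- \<alpha>)" for m
    proof (cases "m = 0")
      case True
      then show ?thesis using c unfolding v by (simp add: comp_sum_0)
    next
      case False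
      have "{..m} = insert 0 {1..m}" by auto
      moreover have "?v j m 0 = 0" using False by (simp add: comp_sum_0)
      ultimately have "(\<Sum>r\<le>m. ?v j m r) = (\<Sum>r=1..m. ?v j m r)" by simp
      then show ?thesis using False unfolding v by (simp add: sum_distrib_left sum_distrib_right)
    qed
    then show ?thesis
      unfolding zeta_coeff_def minus_divide_left[symmetric] \<alpha>_def[symmetric]
      by (simp only: sum_distrib_left sum_distrib_right)
  qed
  ultimately show ?thesis by simp
qed

section \<open>The asymptotic expansion\<close>

lemma exp_neg_tendsto_0:
  fixes a :: real
  assumes "0 < a"
  shows "((\<lambda>k. exp (- a * k)) \<longlongrightarrow> 0) at_top"
  using assms
  by (intro filterlim_compose[OF exp_at_bot] filterlim_tendsto_neg_mult_at_bot[OF tendsto_const])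
     (auto intro: filterlim_ident)

lemma powr_mult_exp_neg_tendsto_0:
  fixes a q :: real
  assumes a: "0 < a"
  shows "((\<lambda>k. k powr q * exp (- a * k)) \<longlongrightarrow> 0) at_top"
proof -
  define n where "n = nat \<lceil>q\<rceil>"
  obtain C where C: "1 \<le> C" "\<And>t. 0 \<le> t \<Longrightarrow> (1 + t) ^ n \<le> C * exp (a / 2 * t)"
    using one_plus_power_le_exp[of "a / 2" n] a by auto
  show ?thesis
  proof (rule Lim_null_comparison)
    show "((\<lambda>k. C * exp (- (a / 2) * k)) \<longlongrightarrow> 0) at_top"
      using tendsto_mult[OF tendsto_const exp_neg_tendsto_0[of "a / 2"]] a by simp
    show "\<forall>\<^sub>F k in at_top. norm (k powr q * exp (- a * k)) \<le> C * exp (- (a / 2) * k)"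
      using eventually_ge_at_top[of "1::real"]
    proof eventually_elim
      case (elim k)
      have "q \<le> real n" unfolding n_def by linarith
      then have "k powr q \<le> k powr real n" using elim by (intro powr_mono) auto
      also have "\<dots> = k ^ n" using elim by (simp add: powr_realpow)
      also have "\<dots> \<le> (1 + k) ^ n" using elim by (intro power_mono) auto
      also have "\<dots> \<le> C * exp (a / 2 * k)" using C elim by simp
      finally have "k powr q * exp (- a * k) \<le> C * exp (a / 2 * k) * exp (- a * k)"
        by (intro mult_right_mono) auto
      also have "\<dots> = C * exp (- (a / 2) * k)" by (simp add: mult.assoc exp_add[symmetric])
      finally show ?case by simp
    qed
  qed
qed

text \<open>
  The exponentials beat every power of \<open>k\<close>, so only the term with \<open>C * \<eta>\<close> survives in the limit, and \<open>\<eta>\<close>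
  is arbitrary.
\<close>

lemma smallo_powr_if_split_bound:
  fixes h :: "real \<Rightarrow> real"
  assumes C: "0 \<le> C"
    and bound: "\<And>\<eta>. 0 < \<eta> \<Longrightarrow> \<eta> \<le> \<kappa> \<Longrightarrow> \<exists>A B a b. 0 < a \<and> 0 < b \<and> (\<forall>\<^sub>F k in at_top.
        \<bar>h k\<bar> \<le> (C * \<eta> + A * exp (- a * k)) * k powr (- q) + B * exp (- b * k))"
    and \<kappa>: "0 < \<kappa>"
  shows "h \<in> o[at_top](\<lambda>k. k powr (- q))"
proof (rule landau_o.smallI)
  fix e :: real assume e: "0 < e"
  define \<eta> where "\<eta> = min \<kappa> (e / (2 * (C + 1)))"
  have \<eta>: "0 < \<eta>" "\<eta> \<le> \<kappa>" using e C \<kappa> by (auto simp: \<eta>_def)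
  have "C * \<eta> \<le> C * (e / (2 * (C + 1)))" using C by (intro mult_left_mono) (auto simp: \<eta>_def)
  also have "\<dots> \<le> e / 2" using C e by (simp add: field_simps)
  finally have C\<eta>: "C * \<eta> \<le> e / 2" .
  obtain A B a b where ab: "0 < a" "0 < b" and ev: "\<forall>\<^sub>F k in at_top.
        \<bar>h k\<bar> \<le> (C * \<eta> + A * exp (- a * k)) * k powr (- q) + B * exp (- b * k)"
    using bound[OF \<eta>] by blast
  have "((\<lambda>k. A * exp (- a * k) + B * (k powr q * exp (- b * k))) \<longlongrightarrow> A * 0 + B * 0) at_top"
    by (intro tendsto_intros exp_neg_tendsto_0 powr_mult_exp_neg_tendsto_0 ab)
  then have "\<forall>\<^sub>F k in at_top. A * exp (- a * k) + B * (k powr q * exp (- b * k)) < e / 2"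
    using e by (intro order_tendstoD(2)) auto
  with ev eventually_gt_at_top[of 0]
  show "\<forall>\<^sub>F k in at_top. norm (h k) \<le> e * norm (k powr (- q))"
  proof eventually_elim
    case (elim k)
    have "k powr q * k powr (- q) = 1" using elim by (simp add: powr_add[symmetric])
    then have "(C * \<eta> + A * exp (- a * k)) * k powr (- q) + B * exp (- b * k) =
        (C * \<eta> + (A * exp (- a * k) + B * (k powr q * exp (- b * k)))) * k powr (- q)"
      by (simp add: algebra_simps)
    also have "\<dots> \<le> e * k powr (- q)"
      using elim C\<eta> by (intro mult_right_mono) auto
    finally show ?case using elim by simp
  qed
qed

theorem corollary3p2:
  fixes f g :: "'a::euclidean_space \<Rightarrow> real"
    and R :: "'a set"
    and F G :: "nat \<Rightarrow> 'a \<Rightarrow> real"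
    and N :: nat
    and \<nu> l k0 :: real
  assumes R: "R \<in> sets lebesgue" "0 \<in> interior R"
    and f_meas: "f \<in> borel_measurable (lebesgue_on R)"
    and g_meas: "g \<in> borel_measurable (lebesgue_on R)"
    and f_min: "f 0 = 0" "\<forall>x\<in>R. x \<noteq> 0 \<longrightarrow> 0 < f x"
    and f_away: "\<forall>\<delta>>0. 0 < (INF x\<in>{x\<in>R. \<delta> \<le> norm x}. ereal (f x))"
    and pos: "0 < N" "0 < \<nu>" "0 < l"
    and F_cont: "\<forall>j\<le>N. continuous_on (sphere 0 1) (F j)"
    and F0_pos: "\<forall>\<Omega>\<in>sphere 0 1. 0 < F 0 \<Omega>"
    and f_exp: "(\<lambda>x. f x - norm x powr \<nu> * (\<Sum>j\<le>N. F j (x /\<^sub>R norm x) * norm x ^ j))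
        \<in> o[at 0](\<lambda>x. norm x powr (real N + \<nu>))"
    and g_exp: "(\<lambda>x. g x - norm x powr (l - real DIM('a)) *
            (\<Sum>j\<le>N. G j (x /\<^sub>R norm x) * norm x ^ j))
        \<in> o[at 0](\<lambda>x. norm x powr (real N + l - real DIM('a)))"
    and k0: "0 < k0" "integrable (lebesgue_on R) (\<lambda>x. exp (- k0 * f x) * g x)"
    and f_lim: "\<exists>L. ((\<lambda>x. norm x powr (- \<nu>) * f x) \<longlongrightarrow> L) (at 0)"
  shows "\<exists>c. (\<forall>\<Omega>\<in>sphere 0 1. F 0 \<Omega> = c)
    \<and> (\<forall>j\<le>N. integrable surface_measure (G j))
    \<and> (\<forall>j\<le>N. \<forall>m\<in>{1..j}. \<forall>r\<in>{1..m}.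
          integrable surface_measure (\<lambda>\<Omega>. G (j - m) \<Omega> * comp_sum F m r \<Omega>))
    \<and> (\<forall>\<^sub>F k in at_top. integrable (lebesgue_on R) (\<lambda>x. exp (- k * f x) * g x))
    \<and> (\<lambda>k. (LINT x|lebesgue_on R. exp (- k * f x) * g x)
            - (\<Sum>j\<le>N. zeta_coeff \<nu> l c F G j * k powr (- (real j + l) / \<nu>)))
        \<in> o[at_top](\<lambda>k. k powr (- (real N + l) / \<nu>))"
proof -
  define d where "d = real DIM('a)"
  define p where "p = l - d"
  have g_exp': "(\<lambda>x. g x - norm x powr p * (\<Sum>j\<le>N. G j (x /\<^sub>R norm x) * norm x ^ j))
      \<in> o[at 0](\<lambda>x. norm x powr (real N + p))"
    using g_exp by (simp add: p_def d_def add_diff_eq)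

  obtain c where c_lim: "((\<lambda>x. norm x powr (- \<nu>) * f x) \<longlongrightarrow> c) (at 0)" using f_lim by blast
  have F0: "F 0 \<Omega> = c" if "\<Omega> \<in> sphere 0 1" for \<Omega>
    by (rule leading_coefficient_constant[OF f_exp c_lim that])
  obtain b :: 'a where "b \<in> Basis" using nonempty_Basis by blast
  then have "b \<in> sphere 0 1" by simp
  then have c: "0 < c" using F0 F0_pos by metis

  have f_nonneg: "0 \<le> f x" if "x \<in> R" for x
    using f_min that by (cases "x = 0") (auto simp: less_imp_le)

  \<comment> \<open>From here on all integrals are taken over the whole space.\<close>
  define E where "E k x = indicator R x * (exp (- k * f x) * g x)" for k x
  have RL: "R \<inter> space lebesgue \<in> sets lebesgue" using R(1) by simp
  have E_iff: "integrable (lebesgue_on R) (\<lambda>x. exp (- k * f x) * g x) \<longleftrightarrow> integrable lebesgue (E k)" for k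
    unfolding integrable_restrict_space[OF RL] E_def by simp
  have E_int: "(LINT x|lebesgue_on R. exp (- k * f x) * g x) = integral\<^sup>L lebesgue (E k)" for k
    unfolding integral_restrict_space[OF RL] E_def by simp
  have E_meas: "E k \<in> borel_measurable lebesgue" for k
  proof -
    have "(\<lambda>x. exp (- k * f x) * g x) \<in> borel_measurable (lebesgue_on R)"
      using f_meas g_meas by simp
    then have "(\<lambda>x. if x \<in> R then exp (- k * f x) * g x else 0) \<in> borel_measurable lebesgue"
      by (rule borel_measurable_if_I[OF _ R(1)])
    also have "(\<lambda>x. if x \<in> R then exp (- k * f x) * g x else 0) = E k"
      by (auto simp: E_def)
    finally show ?thesis .
  qed
  have E_k0: "integrable lebesgue (E k0)" using k0(2) E_iff by blast
  have E_le: "\<bar>E k x\<bar> \<le> exp (- (k - k0) * m) * \<bar>E k0 x\<bar>" if "k0 \<le> k" "x \<in> R \<Longrightarrow> m \<le> f x" for k x m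
  proof (cases "x \<in> R")
    case True
    have "(k - k0) * m \<le> (k - k0) * f x" using that True by (intro mult_left_mono) auto
    then have "- k * f x \<le> - (k - k0) * m + - k0 * f x" by (simp add: algebra_simps)
    then have "exp (- k * f x) \<le> exp (- (k - k0) * m) * exp (- k0 * f x)"
      by (simp only: exp_add[symmetric] exp_le_cancel_iff)
    then have "exp (- k * f x) * \<bar>g x\<bar> \<le> (exp (- (k - k0) * m) * exp (- k0 * f x)) * \<bar>g x\<bar>"
      by (rule mult_right_mono) simp
    then show ?thesis using True by (simp add: E_def abs_mult)
  qed (simp add: E_def)
  have E_integrable: "integrable lebesgue (E k)" if "k0 \<le> k" for k
  proof (rule Bochner_Integration.integrable_bound[OF E_k0 E_meas])
    show "AE x in lebesgue. norm (E k x) \<le> norm (E k0 x)"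
      using E_le[OF that f_nonneg] by (intro always_eventually) simp
  qed

  obtain \<delta>0 where \<delta>0: "0 < \<delta>0" "ball 0 \<delta>0 \<subseteq> R" "\<And>x. x \<in> ball 0 \<delta>0 \<Longrightarrow> f x \<le> c + 1"
  proof -
    have "\<forall>\<^sub>F x in at 0. norm x powr (- \<nu>) * f x < c + 1"
      by (rule order_tendstoD(2)[OF c_lim]) simp
    then obtain r where r: "0 < r" "\<And>x. x \<noteq> 0 \<Longrightarrow> norm x < r \<Longrightarrow> norm x powr (- \<nu>) * f x < c + 1"
      unfolding eventually_at by (auto simp: dist_norm)
    obtain r' where r': "0 < r'" "ball 0 r' \<subseteq> R" using R(2) by (auto simp: mem_interior)
    show thesis
    proof (rule that[of "min r (min r' 1)"])
      fix x :: 'a assume x: "x \<in> ball 0 (min r (min r' 1))"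
      show "f x \<le> c + 1"
      proof (cases "x = 0")
        case False
        have "f x = norm x powr \<nu> * (norm x powr (- \<nu>) * f x)"
          using False by (simp add: powr_minus field_simps)
        also have "\<dots> \<le> norm x powr \<nu> * (c + 1)"
          using r(2)[OF False] x by (intro mult_left_mono) auto
        also have "\<dots> \<le> 1 * (c + 1)"
          using x c pos by (intro mult_right_mono powr_le1) auto
        finally show ?thesis by simp
      qed (use f_min c in simp)
    qed (use r r' in auto)
  qed

  have g_ball: "integrable lebesgue (\<lambda>x. indicator (ball 0 \<delta>0) x * g x)"
  proof (rule Bochner_Integration.integrable_bound)
    show "integrable lebesgue (\<lambda>x. exp (k0 * (c + 1)) * E k0 x)" using E_k0 by simp
    have "(\<lambda>x. if x \<in> R then g x else 0) \<in> borel_measurable lebesgue"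
      by (rule borel_measurable_if_I[OF g_meas R(1)])
    then have "(\<lambda>x. indicator (ball 0 \<delta>0) x * (if x \<in> R then g x else 0)) \<in> borel_measurable lebesgue"
      by (intro borel_measurable_times borel_measurable_indicator) auto
    also have "(\<lambda>x. indicator (ball 0 \<delta>0) x * (if x \<in> R then g x else 0)) = (\<lambda>x. indicator (ball 0 \<delta>0) x * g x)"
      using \<delta>0(2) by (auto simp: fun_eq_iff split: split_indicator)
    finally show "(\<lambda>x. indicator (ball 0 \<delta>0) x * g x) \<in> borel_measurable lebesgue" .
    show "AE x in lebesgue. norm (indicator (ball 0 \<delta>0) x * g x) \<le> norm (exp (k0 * (c + 1)) * E k0 x)"
    proof (rule always_eventually, rule allI)
      fix x :: 'a
      show "norm (indicator (ball 0 \<delta>0) x * g x) \<le> norm (exp (k0 * (c + 1)) * E k0 x)"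
      proof (cases "x \<in> ball 0 \<delta>0")
        case True
        have "0 \<le> k0 * (c + 1) + - k0 * f x"
          using mult_left_mono[OF \<delta>0(3)[OF True], of k0] k0(1) by simp
        then have "1 \<le> exp (k0 * (c + 1)) * exp (- k0 * f x)"
          unfolding exp_add[symmetric] by (subst one_le_exp_iff)
        then have "1 * \<bar>g x\<bar> \<le> (exp (k0 * (c + 1)) * exp (- k0 * f x)) * \<bar>g x\<bar>"
          by (intro mult_right_mono) auto
        then show ?thesis using True \<delta>0(2) by (simp add: E_def abs_mult subset_iff)
      qed simp
    qed
  qed
  have G_int: "integrable surface_measure (G j)" if "j \<le> N" for j
    by (rule coefficient_integrable[OF R g_meas g_exp'[unfolded p_def d_def] pos(3) \<delta>0(1,2) g_ball that])
  have GF_int: "integrable surface_measure (\<lambda>\<Omega>. G (j - m) \<Omega> * comp_sum F m r \<Omega>)" if "j \<le> N" "m \<le> j" for j m r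
    using that F_cont
    by (intro integrable_mult_continuous_surface_measure G_int continuous_on_comp_sum) auto

  obtain L where L: "0 \<le> L" "\<And>\<Omega>. \<Omega> \<in> sphere 0 1 \<Longrightarrow> (\<Sum>n=1..N. \<bar>F n \<Omega>\<bar>) \<le> L"
  proof -
    have "continuous_on (sphere 0 1) (\<lambda>\<Omega>. \<Sum>n=1..N. \<bar>F n \<Omega>\<bar>)"
      using F_cont by (intro continuous_intros) auto
    then have "bounded ((\<lambda>\<Omega>. \<Sum>n=1..N. \<bar>F n \<Omega>\<bar>) ` sphere 0 1)"
      by (intro compact_imp_bounded compact_continuous_image) auto
    then obtain K where K: "\<forall>\<Omega>\<in>sphere 0 1. \<bar>\<Sum>n=1..N. \<bar>F n \<Omega>\<bar>\<bar> \<le> K"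
      unfolding bounded_iff by auto
    show thesis
    proof (rule that[of "max 0 K"])
      fix \<Omega> :: 'a assume "\<Omega> \<in> sphere 0 1"
      with K have "\<bar>\<Sum>n=1..N. \<bar>F n \<Omega>\<bar>\<bar> \<le> K" by blast
      then show "(\<Sum>n=1..N. \<bar>F n \<Omega>\<bar>) \<le> max 0 K" by linarith
    qed simp
  qed

  \<comment> \<open>The weight \<open>W\<close>, the model \<open>M\<close> for \<open>E\<close> and the majorant \<open>V\<close>. The rate \<open>c / 4\<close> in \<open>V\<close> is the decay that the local estimate leaves.\<close>
  define W where "W \<Omega> = 1 + (\<Sum>j\<le>N. \<bar>G j \<Omega>\<bar>)" for \<Omega>
  define M where "M k x = norm x powr p * laplace_model c F G N (x /\<^sub>R norm x) (norm x) (k * norm x powr \<nu>)" for k x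
  define V where "V k x = norm x powr (l + real N - d) * exp (- (c / 4 * k) * norm x powr \<nu>) * W (x /\<^sub>R norm x)" for k x
  define q where "q = (real N + l) / \<nu>"
  define CV where "CV = Gamma q * (c / 4) powr (- q) / \<nu> * integral\<^sup>L surface_measure W"
  have W_int: "integrable surface_measure W"
    unfolding W_def[abs_def]
    by (intro Bochner_Integration.integrable_add integrable_const_surface_measure
        Bochner_Integration.integrable_sum integrable_abs G_int) auto
  have W_nonneg: "0 \<le> W \<Omega>" for \<Omega> unfolding W_def by (intro add_nonneg_nonneg sum_nonneg) auto
  have V_int: "has_bochner_integral lebesgue (V k) (CV * k powr (- q))" if "0 < k" for k
  proof -
    have "has_bochner_integral lebesgue (V k)
        (Gamma ((l + real N) / \<nu>) * (c / 4 * k) powr (- (l + real N) / \<nu>) / \<nu> * integral\<^sup>L surface_measure W)"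
      unfolding V_def[abs_def] d_def
      using c that pos W_int by (intro has_bochner_integral_powr_exp_angular) auto
    moreover have "(l + real N) / \<nu> = q" "- (l + real N) / \<nu> = - q"
      by (simp_all add: q_def add.commute minus_divide_left)
    moreover have "(c / 4 * k) powr (- q) = (c / 4) powr (- q) * k powr (- q)"
      using c that by (simp add: powr_mult[symmetric])
    moreover have "Gamma q * ((c / 4) powr (- q) * k powr (- q)) / \<nu> * integral\<^sup>L surface_measure W =
        CV * k powr (- q)"
      by (simp add: CV_def)
    ultimately show ?thesis by (simp only:)
  qed
  have V_nonneg: "0 \<le> V k x" for k x by (simp add: V_def W_nonneg)
  have CV_nonneg: "0 \<le> CV"
  proof -
    have "0 < q" using pos by (simp add: q_def)
    then show ?thesis
      using pos W_nonneg unfolding CV_def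
      by (intro mult_nonneg_nonneg divide_nonneg_nonneg less_imp_le[OF Gamma_real_pos]
          Bochner_Integration.integral_nonneg) auto
  qed
  have M_int: "has_bochner_integral lebesgue (M k)
      (\<Sum>j\<le>N. zeta_coeff \<nu> l c F G j * k powr (- (real j + l) / \<nu>))" if "0 < k" for k
    unfolding M_def[abs_def] p_def d_def
    using c pos that by (intro has_bochner_integral_laplace_model G_int GF_int) auto

  obtain CA where CA: "0 \<le> CA" "\<And>(\<Omega>::'a) \<rho> t \<eta> \<phi> \<gamma>.
       (\<Sum>n=1..N. \<bar>F n \<Omega>\<bar>) \<le> L \<Longrightarrow> 0 \<le> \<rho> \<Longrightarrow> \<rho> \<le> 1 \<Longrightarrow> L * \<rho> \<le> c / 4 \<Longrightarrow> 0 \<le> t \<Longrightarrow>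
       0 \<le> \<eta> \<Longrightarrow> \<eta> \<le> c / 4 \<Longrightarrow> \<eta> \<le> 1 \<Longrightarrow>
       \<bar>\<phi> - (c + (\<Sum>n=1..N. F n \<Omega> * \<rho> ^ n))\<bar> \<le> \<eta> * \<rho> ^ N \<Longrightarrow>
       \<bar>\<gamma> - (\<Sum>j\<le>N. G j \<Omega> * \<rho> ^ j)\<bar> \<le> \<eta> * \<rho> ^ N \<Longrightarrow>
       \<bar>exp (- t * \<phi>) * \<gamma> - laplace_model c F G N \<Omega> \<rho> t\<bar> \<le>
         CA * (\<eta> + \<rho>) * \<rho> ^ N * exp (- c * t / 4) * (1 + (\<Sum>j\<le>N. \<bar>G j \<Omega>\<bar>))"
    by (rule laplace_model_local[OF c L(1), where F = F and G = G and N = N]) (rule that)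
  note CA = CA(1) CA(2)[folded W_def]

  have bound: "\<exists>A B a b. 0 < a \<and> 0 < b \<and> (\<forall>\<^sub>F k in at_top.
      \<bar>integral\<^sup>L lebesgue (E k) - (\<Sum>j\<le>N. zeta_coeff \<nu> l c F G j * k powr (- (real j + l) / \<nu>))\<bar> \<le>
        (2 * CA * CV * \<eta> + A * exp (- a * k)) * k powr (- q) + B * exp (- b * k))"
    if \<eta>: "0 < \<eta>" "\<eta> \<le> min 1 (c / 4)" for \<eta>
  proof -
    have "\<forall>\<^sub>F x in at 0.
        \<bar>norm x powr (- \<nu>) * f x - (\<Sum>j\<le>N. F j (x /\<^sub>R norm x) * norm x ^ j)\<bar> \<le> \<eta> * norm x ^ N \<and>
        \<bar>norm x powr (- p) * g x - (\<Sum>j\<le>N. G j (x /\<^sub>R norm x) * norm x ^ j)\<bar> \<le> \<eta> * norm x ^ N"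
      by (intro eventually_conj polar_expansionD[OF f_exp] polar_expansionD[OF g_exp'] \<eta>)
    then obtain \<delta>1 where \<delta>1: "0 < \<delta>1" "\<And>x. x \<noteq> 0 \<Longrightarrow> norm x < \<delta>1 \<Longrightarrow>
        \<bar>norm x powr (- \<nu>) * f x - (\<Sum>j\<le>N. F j (x /\<^sub>R norm x) * norm x ^ j)\<bar> \<le> \<eta> * norm x ^ N \<and>
        \<bar>norm x powr (- p) * g x - (\<Sum>j\<le>N. G j (x /\<^sub>R norm x) * norm x ^ j)\<bar> \<le> \<eta> * norm x ^ N"
      unfolding eventually_at by (auto simp: dist_norm)
    \<comment> \<open>The radius is at most \<open>\<eta>\<close> so that \<open>\<eta> + \<rho> \<le> 2 * \<eta>\<close>; the last entry gives \<open>L * \<rho> \<le> c / 4\<close>.\<close>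
    define \<delta> where "\<delta> = Min {\<delta>0, \<delta>1, 1, \<eta>, c / (4 * (L + 1))}"
    have \<delta>: "0 < \<delta>" "\<delta> \<le> \<delta>0" "\<delta> \<le> \<delta>1" "\<delta> \<le> 1" "\<delta> \<le> \<eta>" "\<delta> \<le> c / (4 * (L + 1))"
      using \<delta>0(1) \<delta>1(1) \<eta> c L(1) by (auto simp: \<delta>_def)
    have near: "\<bar>E k x - M k x\<bar> \<le> 2 * CA * \<eta> * V k x"
      if x: "x \<noteq> 0" "norm x < \<delta>" and k: "0 < k" for x k
    proof -
      define \<Omega> where "\<Omega> = x /\<^sub>R norm x"
      define \<rho> where "\<rho> = norm x"
      define t where "t = k * \<rho> powr \<nu>"
      have \<Omega>: "\<Omega> \<in> sphere 0 1" using x by (simp add: \<Omega>_def)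
      have \<rho>: "0 < \<rho>" "\<rho> \<le> 1" "\<rho> \<le> \<eta>" using x \<delta> by (auto simp: \<rho>_def)
      have t: "0 \<le> t" using k by (simp add: t_def)
      have V_eq: "V k x = \<rho> powr (l + real N - d) * exp (- c * t / 4) * W \<Omega>"
        by (simp add: V_def \<rho>_def \<Omega>_def t_def mult_ac)
      have "(L + 1) * \<rho> \<le> (L + 1) * (c / (4 * (L + 1)))"
        using x \<delta> L(1) by (intro mult_left_mono) (auto simp: \<rho>_def)
      also have "\<dots> = c / 4" using L(1) by (simp add: divide_simps)
      finally have L\<rho>: "L * \<rho> \<le> c / 4" using \<rho> by (simp add: distrib_right)
      have exps: "\<bar>\<rho> powr (- \<nu>) * f x - (\<Sum>j\<le>N. F j \<Omega> * \<rho> ^ j)\<bar> \<le> \<eta> * \<rho> ^ N"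
          "\<bar>\<rho> powr (- p) * g x - (\<Sum>j\<le>N. G j \<Omega> * \<rho> ^ j)\<bar> \<le> \<eta> * \<rho> ^ N"
        using \<delta>1(2)[of x] x \<delta> unfolding \<rho>_def \<Omega>_def by auto
      have "{..N} = insert 0 {1..N}" by auto
      then have "(\<Sum>j\<le>N. F j \<Omega> * \<rho> ^ j) = c + (\<Sum>n=1..N. F n \<Omega> * \<rho> ^ n)"
        using F0[OF \<Omega>] by simp
      with exps(1) have fexp: "\<bar>\<rho> powr (- \<nu>) * f x - (c + (\<Sum>n=1..N. F n \<Omega> * \<rho> ^ n))\<bar> \<le> \<eta> * \<rho> ^ N"
        by simp
      have loc: "\<bar>exp (- t * (\<rho> powr (- \<nu>) * f x)) * (\<rho> powr (- p) * g x) - laplace_model c F G N \<Omega> \<rho> t\<bar> \<le>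
          CA * (\<eta> + \<rho>) * \<rho> ^ N * exp (- c * t / 4) * W \<Omega>"
        using \<eta> \<rho> t L\<rho> L(2)[OF \<Omega>] fexp exps(2) by (intro CA(2)) auto
      have "\<rho> powr \<nu> * \<rho> powr (- \<nu>) = 1" "\<rho> powr p * \<rho> powr (- p) = 1"
        using \<rho> by (simp_all add: powr_add[symmetric])
      then have cancel: "t * (\<rho> powr (- \<nu>) * f x) = k * f x" "\<rho> powr p * (\<rho> powr (- p) * g x) = g x"
        unfolding t_def by (simp_all add: mult.assoc[symmetric])
      have "x \<in> R" using x \<delta> \<delta>0(2) by auto
      then have "E k x = exp (- t * (\<rho> powr (- \<nu>) * f x)) * (\<rho> powr p * (\<rho> powr (- p) * g x))"
        unfolding mult_minus_left cancel by (simp add: E_def)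
      moreover have "M k x = \<rho> powr p * laplace_model c F G N \<Omega> \<rho> t"
        unfolding M_def \<Omega>_def t_def \<rho>_def ..
      ultimately have "E k x - M k x = \<rho> powr p * (exp (- t * (\<rho> powr (- \<nu>) * f x)) * (\<rho> powr (- p) * g x) -
          laplace_model c F G N \<Omega> \<rho> t)"
        by (simp only: right_diff_distrib mult.left_commute)
      then have "\<bar>E k x - M k x\<bar> \<le> \<rho> powr p * (CA * (\<eta> + \<rho>) * \<rho> ^ N * exp (- c * t / 4) * W \<Omega>)"
        using mult_left_mono[OF loc, of "\<rho> powr p"] by (simp add: abs_mult)
      also have "\<dots> \<le> \<rho> powr p * (CA * (2 * \<eta>) * \<rho> ^ N * exp (- c * t / 4) * W \<Omega>)"
        using \<rho> CA(1) W_nonneg by (intro mult_left_mono mult_right_mono) auto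
      also have "\<dots> = 2 * CA * \<eta> * ((\<rho> powr p * \<rho> ^ N) * exp (- c * t / 4) * W \<Omega>)"
        by (simp add: mult_ac)
      also have "\<rho> powr p * \<rho> ^ N = \<rho> powr (l + real N - d)"
        using \<rho> by (simp add: p_def powr_realpow[symmetric] powr_add[symmetric] algebra_simps)
      finally show ?thesis unfolding V_eq .
    qed
    obtain CT where CT: "0 \<le> CT" "\<And>(\<Omega>::'a) \<rho> t.
       (\<Sum>n=1..N. \<bar>F n \<Omega>\<bar>) \<le> L \<Longrightarrow> \<delta> \<le> \<rho> \<Longrightarrow> 0 \<le> t \<Longrightarrow>
       \<bar>laplace_model c F G N \<Omega> \<rho> t\<bar> \<le> CT * \<rho> ^ N * exp (- c * t / 2) *
         (1 + (\<Sum>j\<le>N. \<bar>G j \<Omega>\<bar>))"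
      by (rule laplace_model_tail[OF c L(1) \<delta>(1), where F = F and G = G and N = N]) (rule that)
    note CT = CT(1) CT(2)[folded W_def]
    define a where "a = c / 4 * \<delta> powr \<nu>"
    have a: "0 < a" using c \<delta> by (simp add: a_def)
    have M_far: "\<bar>M k x\<bar> \<le> CT * exp (- a * k) * V k x" if x: "\<delta> \<le> norm x" and k: "0 < k" for x k
    proof -
      define \<Omega> where "\<Omega> = x /\<^sub>R norm x"
      define \<rho> where "\<rho> = norm x"
      define t where "t = k * \<rho> powr \<nu>"
      have "x \<noteq> 0" using x \<delta> by auto
      then have \<Omega>: "\<Omega> \<in> sphere 0 1" by (simp add: \<Omega>_def)
      have \<rho>: "\<delta> \<le> \<rho>" "0 < \<rho>" using x \<delta> by (auto simp: \<rho>_def)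
      have t: "0 \<le> t" using k by (simp add: t_def)
      have V_eq: "V k x = \<rho> powr (l + real N - d) * exp (- c * t / 4) * W \<Omega>"
        by (simp add: V_def \<rho>_def \<Omega>_def t_def mult_ac)
      \<comment> \<open>Half of the decay \<open>exp (- c * t / 2)\<close> becomes exponential decay in \<open>k\<close>, the other half remains in \<open>V\<close>.\<close>
      have "\<delta> powr \<nu> \<le> \<rho> powr \<nu>" using \<rho> \<delta> pos by (intro powr_mono2) auto
      then have "a * k \<le> c * t / 4"
        using c k by (simp add: a_def t_def)
      then have "exp (- c * t / 2) \<le> exp (- a * k + - c * t / 4)" by simp
      then have e: "exp (- c * t / 2) \<le> exp (- a * k) * exp (- c * t / 4)" by (simp only: exp_add)
      have "\<bar>M k x\<bar> = \<rho> powr p * \<bar>laplace_model c F G N \<Omega> \<rho> t\<bar>"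
        by (simp add: M_def abs_mult \<rho>_def \<Omega>_def t_def)
      also have "\<dots> \<le> \<rho> powr p * (CT * \<rho> ^ N * exp (- c * t / 2) * W \<Omega>)"
        by (intro mult_left_mono CT(2) L(2) \<Omega> \<rho> t) auto
      also have "\<dots> \<le> \<rho> powr p * (CT * \<rho> ^ N * (exp (- a * k) * exp (- c * t / 4)) * W \<Omega>)"
        using e CT(1) W_nonneg \<rho> by (intro mult_left_mono mult_right_mono) auto
      also have "\<dots> = CT * exp (- a * k) * ((\<rho> powr p * \<rho> ^ N) * exp (- c * t / 4) * W \<Omega>)"
        by (simp add: mult_ac)
      also have "\<rho> powr p * \<rho> ^ N = \<rho> powr (l + real N - d)"
        using \<rho> by (simp add: p_def powr_realpow[symmetric] powr_add[symmetric] algebra_simps)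
      finally show ?thesis unfolding V_eq .
    qed
    obtain m where m: "0 < m" "\<And>x. x \<in> R \<Longrightarrow> \<delta> \<le> norm x \<Longrightarrow> m \<le> f x"
    proof -
      have "0 < (INF x\<in>{x\<in>R. \<delta> \<le> norm x}. ereal (f x))" using f_away \<delta>(1) by blast
      then obtain m where m: "0 < ereal m" "ereal m < (INF x\<in>{x\<in>R. \<delta> \<le> norm x}. ereal (f x))"
        using ereal_dense2 by blast
      show thesis
      proof (rule that[of m])
        fix x assume "x \<in> R" "\<delta> \<le> norm x"
        then have "(INF x\<in>{x\<in>R. \<delta> \<le> norm x}. ereal (f x)) \<le> ereal (f x)" by (intro INF_lower) auto
        then have "ereal m < ereal (f x)" using m(2) by (rule less_le_trans[rotated])
        then show "m \<le> f x" by simp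
      qed (use m in simp)
    qed
    define B where "B = exp (k0 * m) * (LINT x|lebesgue. \<bar>E k0 x\<bar>)"
    have "\<bar>integral\<^sup>L lebesgue (E k) - (\<Sum>j\<le>N. zeta_coeff \<nu> l c F G j * k powr (- (real j + l) / \<nu>))\<bar> \<le>
        (2 * CA * CV * \<eta> + CT * CV * exp (- a * k)) * k powr (- q) + B * exp (- m * k)" if k: "k0 \<le> k" for k
    proof -
      have k_pos: "0 < k" using k k0(1) by simp
      let ?D = "\<lambda>x. (2 * CA * \<eta> + CT * exp (- a * k)) * V k x + exp (- (k - k0) * m) * \<bar>E k0 x\<bar>"
      have pointwise: "\<bar>E k x - M k x\<bar> \<le> ?D x" if "x \<noteq> 0" for x
      proof (cases "norm x < \<delta>")
        case True
        have "0 \<le> CT * exp (- a * k) * V k x" "0 \<le> exp (- (k - k0) * m) * \<bar>E k0 x\<bar>"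
          using CT(1) V_nonneg by auto
        then show ?thesis using near[OF that True k_pos] unfolding distrib_right by linarith
      next
        case False
        then have x: "\<delta> \<le> norm x" by simp
        have "\<bar>E k x\<bar> \<le> exp (- (k - k0) * m) * \<bar>E k0 x\<bar>"
          by (rule E_le[OF k m(2)[OF _ x]])
        moreover have "\<bar>M k x\<bar> \<le> CT * exp (- a * k) * V k x" by (rule M_far[OF x k_pos])
        moreover have "0 \<le> 2 * CA * \<eta> * V k x" using CA(1) \<eta> V_nonneg by simp
        moreover have "\<bar>E k x - M k x\<bar> \<le> \<bar>E k x\<bar> + \<bar>M k x\<bar>" by (rule abs_triangle_ineq4)
        ultimately show ?thesis unfolding distrib_right by linarith
      qed
      have M_integrable: "integrable lebesgue (M k)" using M_int[OF k_pos] by (rule integrable.intros)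
      have M_value: "integral\<^sup>L lebesgue (M k) = (\<Sum>j\<le>N. zeta_coeff \<nu> l c F G j * k powr (- (real j + l) / \<nu>))"
        using M_int[OF k_pos] by (rule has_bochner_integral_integral_eq)
      have V_integrable: "integrable lebesgue (V k)" using V_int[OF k_pos] by (rule integrable.intros)
      have V_value: "integral\<^sup>L lebesgue (V k) = CV * k powr (- q)"
        using V_int[OF k_pos] by (rule has_bochner_integral_integral_eq)
      have "\<bar>integral\<^sup>L lebesgue (E k) - integral\<^sup>L lebesgue (M k)\<bar> = \<bar>LINT x|lebesgue. E k x - M k x\<bar>"
        by (simp add: E_integrable[OF k] M_integrable)
      also have "\<dots> \<le> (LINT x|lebesgue. \<bar>E k x - M k x\<bar>)"
        by (rule integral_abs_bound)
      also have "\<dots> \<le> integral\<^sup>L lebesgue ?D"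
      proof (rule integral_mono_AE)
        show "integrable lebesgue (\<lambda>x. \<bar>E k x - M k x\<bar>)"
          by (intro integrable_abs Bochner_Integration.integrable_diff E_integrable[OF k] M_integrable)
        show "integrable lebesgue ?D"
          by (intro Bochner_Integration.integrable_add integrable_mult_right V_integrable integrable_abs E_k0)
        have "AE x in lebesgue. x \<noteq> (0::'a)"
          by (rule AE_completion[OF AE_lborel_singleton])
        then show "AE x in lebesgue. \<bar>E k x - M k x\<bar> \<le> ?D x"
          by eventually_elim (rule pointwise)
      qed
      also have "\<dots> = (2 * CA * \<eta> + CT * exp (- a * k)) * (CV * k powr (- q)) +
          exp (- (k - k0) * m) * (LINT x|lebesgue. \<bar>E k0 x\<bar>)"
        by (simp add: V_integrable V_value E_k0)
      also have "exp (- (k - k0) * m) = exp (k0 * m) * exp (- m * k)"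
        by (simp add: exp_add[symmetric] algebra_simps)
      finally show ?thesis unfolding M_value B_def by (simp add: algebra_simps)
    qed
    then have "\<forall>\<^sub>F k in at_top.
        \<bar>integral\<^sup>L lebesgue (E k) - (\<Sum>j\<le>N. zeta_coeff \<nu> l c F G j * k powr (- (real j + l) / \<nu>))\<bar> \<le>
        (2 * CA * CV * \<eta> + CT * CV * exp (- a * k)) * k powr (- q) + B * exp (- m * k)"
      by (rule eventually_mono[OF eventually_ge_at_top])
    then show ?thesis using a m(1) by blast
  qed
  have expansion: "(\<lambda>k. integral\<^sup>L lebesgue (E k) -
      (\<Sum>j\<le>N. zeta_coeff \<nu> l c F G j * k powr (- (real j + l) / \<nu>))) \<in> o[at_top](\<lambda>k. k powr (- q))"
    by (rule smallo_powr_if_split_bound[where \<kappa> = "min 1 (c / 4)", OF _ bound])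
       (use CA(1) CV_nonneg c in auto)

  show ?thesis
  proof (intro exI[of _ c] conjI)
    show "\<forall>\<^sub>F k in at_top. integrable (lebesgue_on R) (\<lambda>x. exp (- k * f x) * g x)"
      unfolding E_iff using eventually_ge_at_top[of k0] by eventually_elim (rule E_integrable)
    show "(\<lambda>k. (LINT x|lebesgue_on R. exp (- k * f x) * g x)
            - (\<Sum>j\<le>N. zeta_coeff \<nu> l c F G j * k powr (- (real j + l) / \<nu>)))
        \<in> o[at_top](\<lambda>k. k powr (- (real N + l) / \<nu>))"
      using expansion unfolding E_int q_def minus_divide_left .
  qed (use F0 G_int GF_int in auto)
qed

end
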